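(* With $k$, $V$, $R$, the left differentials $d_n^\ell$, the Yang-Baxter differentials $d_n$, the maps $g_m,g'_m,h_m,h'_m$ ($m\ge 1$), and the index set $S(n)$ defined in the context, for every $n\ge 1$ the left differential is $$d_n^\ell=(-1)^n\sum_{S(n)} g'_{i_0}\, g_{i_1}^{k(1)}\cdots g_{i_h}^{k(h)}\, g_1^{2q},$$ and the $n$-th Yang-Baxter differential decomposes as $$d_n=-\sum_{S(n)} g'_{i_0}\, g_{i_1}^{k(1)}\cdots g_{i_h}^{k(h)}\, g_1^{2q}+\sum_{S(n)} h_1^{2q}\, h_{i_h}^{k(h)}\cdots h_{i_1}^{k(1)}\,h'_{i_0}\qquad\text{if } n \text{ is odd},$$ $$d_n=\sum_{S(n)} g'_{i_0}\, g_{i_1}^{k(1)}\cdots g_{i_h}^{k(h)}\, g_1^{2q}+\sum_{S(n)} h_1^{2q}\, h_{i_h}^{k(h)}\cdots h_{i_1}^{k(1)}\,h'_{i_0}\qquad\text{if } n \text{ is even}.$$ Here products and powers of the $g$'s and $h$'s denote tensor products of maps (horizontal concatenation), in the written order from left to right.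
   Context: Let $k=\mathbb{Q}[y,y^{-1}]$ and let $V$ be the free $k$-module with basis $e_1,e_2$; tensor products are over $k$, $\mathbb{1}$ is the identity of $V$ and $\mathbb{1}^m$ the identity of $V^{\otimes m}$ ($V^{\otimes 0}=k$). Let $R:V\otimes V\to V\otimes V$ be given by $R(e_1\otimes e_1)=e_1\otimes e_1$, $R(e_1\otimes e_2)=(1-y^2)e_1\otimes e_2+y^2e_2\otimes e_1$, $R(e_2\otimes e_1)=e_1\otimes e_2$, $R(e_2\otimes e_2)=e_2\otimes e_2$. Let $\mu:V\to k$ be the $k$-linear map with $\mu(e_1)=\mu(e_2)=1$ (trivial left and right action on $k$). For $1\le i\le n$ define $d^\ell_{i,n},d^r_{i,n}:V^{\otimes n}\to V^{\otimes(n-1)}$ by $$d^\ell_{i,n}=(\mu\otimes\mathbb{1}^{n-1})\circ(R\otimes\mathbb{1}^{n-2})\circ(\mathbb{1}\otimes R\otimes\mathbb{1}^{n-3})\circ\cdots\circ(\mathbb{1}^{i-2}\otimes R\otimes\mathbb{1}^{n-i}),$$ $$d^r_{i,n}=(\mathbb{1}^{n-1}\otimes\mu)\circ(\mathbb{1}^{n-2}\otimes R)\circ(\mathbb{1}^{n-3}\otimes R\otimes\mathbb{1})\circ\cdots\circ(\mathbb{1}^{i-1}\otimes R\otimes\mathbb{1}^{n-i-1}),$$ (so $d^\ell_{1,n}=\mu\otimes\mathbb{1}^{n-1}$ and $d^r_{n,n}=\mathbb{1}^{n-1}\otimes\mu$, with no factor $R$). Set $d^\ell_n=\sum_{i=1}^n(-1)^i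 d^\ell_{i,n}$ and $d_n=\sum_{i=1}^n(-1)^i\,[\,d^\ell_{i,n}-d^r_{i,n}\,]$. Let $\alpha:V\otimes V\to k$, $\beta:k\to V\otimes V$ be $k$-linear with $\alpha(e_1\otimes e_1)=\alpha(e_2\otimes e_2)=0$, $\alpha(e_1\otimes e_2)=-y$, $\alpha(e_2\otimes e_1)=y^{-1}$, $\beta(1)=y(e_1\otimes e_2-e_2\otimes e_1)$. Let $\xi,\zeta:V\to V$ be $k$-linear with $\xi(e_1)=y^2e_1$, $\xi(e_2)=e_2$, $\zeta(e_1)=e_1$, $\zeta(e_2)=y^2e_2$. Let $\lambda_\ell,\lambda_r:k\to V$ be $\lambda_\ell(1)=y(e_2-e_1)$, $\lambda_r(1)=y(e_1-e_2)$. Generators: $g_1=h_1=\mathbb{1}$, $g'_1=h'_1=\mu$, and for $m\ge2$ $$g_m=\beta\otimes\xi^{\otimes(m-2)}\otimes\alpha,\quad h_m=\alpha\otimes\zeta^{\otimes(m-2)}\otimes\beta:\ V^{\otimes m}\to V^{\otimes m},$$ $$g'_m=\lambda_\ell\otimes\xi^{\otimes(m-2)}\otimes\alpha,\quad h'_m=\alpha\otimes\zeta^{\otimes(m-2)}\otimes\lambda_r:\ V^{\otimes m}\to V^{\otimes(m-1)}.$$ Index set: $S(n)$ is the set of all tuples $(i_0,i_1,\dots,i_h;k(1),\dots,k(h);q)$ with $h\ge0$, all $i_j\ge1$, all $k(j)\ge1$, $q\ge0$, consecutive $i_j\neq i_{j+1}$ for $1\le j<h$ (so that each word in the generators is listed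 once), $i_h\ne1$ if $h\ge1$, and $i_0+k(1)i_1+\cdots+k(h)i_h+2q=n$. *)

theory Defs
  imports Complex_Main "HOL-Library.Poly_Mapping"
begin

section \<open>The ring \<open>k = \<rat>[y, y\<^sup>-\<^sup>1]\<close>\<close>

text \<open>Laurent polynomials are the group ring of \<open>\<int>\<close> over \<open>\<rat>\<close>: finitely supported functions
  \<open>\<int> \<Rightarrow> \<rat>\<close> with the convolution product.\<close>

type_synonym laurent = "int \<Rightarrow>\<^sub>0 rat"

definition yv :: laurent where
  "yv = Poly_Mapping.single 1 1"

definition yinv :: laurent where
  "yinv = Poly_Mapping.single (- 1) 1"

lemma yv_yinv: "yv * yinv = 1"
  by (simp add: yv_def yinv_def Poly_Mapping.mult_single)


section \<open>Tensor powers of \<open>V\<close>\<close>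

datatype basis = E1 | E2

text \<open>Words form the free monoid under concatenation.  Hence \<open>basis list \<Rightarrow>\<^sub>0 laurent\<close>, with the
  convolution product of \<^theory>\<open>HOL-Library.Poly_Mapping\<close>, is the tensor algebra of \<open>V\<close>: the word
  \<open>[b\<^sub>1, \<dots>, b\<^sub>n]\<close> is \<open>b\<^sub>1 \<otimes> \<dots> \<otimes> b\<^sub>n\<close>, the product \<open>*\<close> is \<open>\<otimes>\<close>, and the \<open>n\<close>-th tensor power is the free
  \<open>k\<close>-module on the words of length \<open>n\<close>, with \<open>V\<^sup>\<otimes>\<^sup>p \<otimes> V\<^sup>\<otimes>\<^sup>q = V\<^sup>\<otimes>\<^sup>(\<^sup>p\<^sup>+\<^sup>q\<^sup>)\<close>.  The empty word spans \<open>k\<close>.\<close>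

instantiation list :: (type) monoid_add
begin

definition plus_list :: "'a list \<Rightarrow> 'a list \<Rightarrow> 'a list" where
  "plus_list u v = u @ v"

definition zero_list :: "'a list" where
  "zero_list = []"

instance
  by standard (simp_all add: plus_list_def zero_list_def)

end

type_synonym tensor = "basis list \<Rightarrow>\<^sub>0 laurent"

definition tpower :: "nat \<Rightarrow> tensor set" where
  "tpower n = {x. \<forall>w \<in> Poly_Mapping.keys x. length w = n}"

definition e :: "basis list \<Rightarrow> tensor" where
  "e w = Poly_Mapping.single w 1"

definition scal :: "laurent \<Rightarrow> tensor" where
  "scal c = Poly_Mapping.single [] c"

definition scale :: "laurent \<Rightarrow> tensor \<Rightarrow> tensor" (infixr \<open>*\<^sub>k\<close> 75) where
  "c *\<^sub>k x = scal c * x"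

text \<open>The \<open>k\<close>-linear extension of a map given on basis words.\<close>

definition lin :: "(basis list \<Rightarrow> tensor) \<Rightarrow> tensor \<Rightarrow> tensor" where
  "lin \<phi> x = (\<Sum>w \<in> Poly_Mapping.keys x. Poly_Mapping.lookup x w *\<^sub>k \<phi> w)"


section \<open>Linear maps between tensor powers\<close>

text \<open>\<open>LMap m n F\<close> stands for the linear map \<open>V\<^sup>\<otimes>\<^sup>m \<rightarrow> V\<^sup>\<otimes>\<^sup>n\<close> given by \<open>F\<close>; the values of \<open>F\<close> outside
  \<open>tpower m\<close> are irrelevant.\<close>

datatype lmap = LMap (src: nat) (tgt: nat) (app: "tensor \<Rightarrow> tensor")

definition is_hom :: "lmap \<Rightarrow> bool" where
  "is_hom f \<longleftrightarrow>
     (\<forall>x y. app f (x + y) = app f x + app f y) \<and>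
     (\<forall>c x. app f (c *\<^sub>k x) = c *\<^sub>k app f x) \<and>
     (\<forall>x \<in> tpower (src f). app f x \<in> tpower (tgt f))"

definition idm :: "nat \<Rightarrow> lmap" where
  "idm n = LMap n n (\<lambda>x. x)"

definition compose :: "lmap \<Rightarrow> lmap \<Rightarrow> lmap" (infixr \<open>\<circ>\<^sub>m\<close> 60) where
  "f \<circ>\<^sub>m g = LMap (src g) (tgt f) (app f \<circ> app g)"

definition tens :: "lmap \<Rightarrow> lmap \<Rightarrow> lmap" (infixr \<open>\<otimes>\<^sub>m\<close> 70) where
  "f \<otimes>\<^sub>m g = LMap (src f + src g) (tgt f + tgt g)
     (lin (\<lambda>w. app f (e (take (src f) w)) * app g (e (drop (src f) w))))"

definition tens_list :: "lmap list \<Rightarrow> lmap" where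
  "tens_list fs = foldr (\<otimes>\<^sub>m) fs (idm 0)"


section \<open>The structure maps\<close>

fun R_basis :: "basis list \<Rightarrow> tensor" where
  "R_basis [E1, E1] = e [E1, E1]"
| "R_basis [E1, E2] = (1 - yv^2) *\<^sub>k e [E1, E2] + yv^2 *\<^sub>k e [E2, E1]"
| "R_basis [E2, E1] = e [E1, E2]"
| "R_basis [E2, E2] = e [E2, E2]"
| "R_basis _ = 0"

fun mu_basis :: "basis list \<Rightarrow> tensor" where
  "mu_basis [E1] = scal 1"
| "mu_basis [E2] = scal 1"
| "mu_basis _ = 0"

fun alpha_basis :: "basis list \<Rightarrow> tensor" where
  "alpha_basis [E1, E2] = scal (- yv)"
| "alpha_basis [E2, E1] = scal yinv"
| "alpha_basis _ = 0"

fun beta_basis :: "basis list \<Rightarrow> tensor" where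
  "beta_basis [] = yv *\<^sub>k (e [E1, E2] - e [E2, E1])"
| "beta_basis _ = 0"

fun xi_basis :: "basis list \<Rightarrow> tensor" where
  "xi_basis [E1] = yv^2 *\<^sub>k e [E1]"
| "xi_basis [E2] = e [E2]"
| "xi_basis _ = 0"

fun zeta_basis :: "basis list \<Rightarrow> tensor" where
  "zeta_basis [E1] = e [E1]"
| "zeta_basis [E2] = yv^2 *\<^sub>k e [E2]"
| "zeta_basis _ = 0"

fun lambda_l_basis :: "basis list \<Rightarrow> tensor" where
  "lambda_l_basis [] = yv *\<^sub>k (e [E2] - e [E1])"
| "lambda_l_basis _ = 0"

fun lambda_r_basis :: "basis list \<Rightarrow> tensor" where
  "lambda_r_basis [] = yv *\<^sub>k (e [E1] - e [E2])"
| "lambda_r_basis _ = 0"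

definition R_map :: lmap where "R_map = LMap 2 2 (lin R_basis)"
definition mu_map :: lmap where "mu_map = LMap 1 0 (lin mu_basis)"
definition alpha_map :: lmap where "alpha_map = LMap 2 0 (lin alpha_basis)"
definition beta_map :: lmap where "beta_map = LMap 0 2 (lin beta_basis)"
definition xi_map :: lmap where "xi_map = LMap 1 1 (lin xi_basis)"
definition zeta_map :: lmap where "zeta_map = LMap 1 1 (lin zeta_basis)"
definition lambda_l_map :: lmap where "lambda_l_map = LMap 0 1 (lin lambda_l_basis)"
definition lambda_r_map :: lmap where "lambda_r_map = LMap 0 1 (lin lambda_r_basis)"


section \<open>The differentials\<close>

text \<open>\<open>R_at p n\<close> is \<open>R\<close> acting on the tensor factors \<open>p\<close> and \<open>p + 1\<close> (counted from 1) of \<open>V\<^sup>\<otimes>\<^sup>n\<close>; it is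
  only used for \<open>1 \<le> p < n\<close>.\<close>

definition R_at :: "nat \<Rightarrow> nat \<Rightarrow> lmap" where
  "R_at p n = idm (p - 1) \<otimes>\<^sub>m R_map \<otimes>\<^sub>m idm (n - p - 1)"

text \<open>\<open>d_left i n = (\<mu> \<otimes> 1) \<circ> R_at 1 n \<circ> \<dots> \<circ> R_at (i - 1) n\<close> and
  \<open>d_right i n = (1 \<otimes> \<mu>) \<circ> R_at (n - 1) n \<circ> \<dots> \<circ> R_at i n\<close>.\<close>

definition d_left :: "nat \<Rightarrow> nat \<Rightarrow> lmap" where
  "d_left i n =
     (mu_map \<otimes>\<^sub>m idm (n - 1)) \<circ>\<^sub>m foldr (\<circ>\<^sub>m) (map (\<lambda>p. R_at p n) [1..<i]) (idm n)"

definition d_right :: "nat \<Rightarrow> nat \<Rightarrow> lmap" where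
  "d_right i n =
     (idm (n - 1) \<otimes>\<^sub>m mu_map) \<circ>\<^sub>m foldr (\<circ>\<^sub>m) (map (\<lambda>p. R_at p n) (rev [i..<n])) (idm n)"

definition left_diff :: "nat \<Rightarrow> lmap" where
  "left_diff n = LMap n (n - 1) (\<lambda>x. \<Sum>i=1..n. (- 1) ^ i * app (d_left i n) x)"

definition yb_diff :: "nat \<Rightarrow> lmap" where
  "yb_diff n = LMap n (n - 1)
     (\<lambda>x. \<Sum>i=1..n. (- 1) ^ i * (app (d_left i n) x - app (d_right i n) x))"


section \<open>The generators and the index set\<close>

text \<open>The following are only used for \<open>m \<ge> 1\<close>.\<close>

definition gmap :: "nat \<Rightarrow> lmap" where
  "gmap m = (if m = 1 then idm 1
     else beta_map \<otimes>\<^sub>m tens_list (replicate (m - 2) xi_map) \<otimes>\<^sub>m alpha_map)"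

definition gmap' :: "nat \<Rightarrow> lmap" where
  "gmap' m = (if m = 1 then mu_map
     else lambda_l_map \<otimes>\<^sub>m tens_list (replicate (m - 2) xi_map) \<otimes>\<^sub>m alpha_map)"

definition hmap :: "nat \<Rightarrow> lmap" where
  "hmap m = (if m = 1 then idm 1
     else alpha_map \<otimes>\<^sub>m tens_list (replicate (m - 2) zeta_map) \<otimes>\<^sub>m beta_map)"

definition hmap' :: "nat \<Rightarrow> lmap" where
  "hmap' m = (if m = 1 then mu_map
     else alpha_map \<otimes>\<^sub>m tens_list (replicate (m - 2) zeta_map) \<otimes>\<^sub>m lambda_r_map)"

text \<open>The tuple \<open>(i\<^sub>0, \<dots>, i\<^sub>h; k(1), \<dots>, k(h); q)\<close> is encoded as
  \<open>(i\<^sub>0, [(i\<^sub>1, k(1)), \<dots>, (i\<^sub>h, k(h))], q)\<close>; the list is empty for \<open>h = 0\<close>.\<close>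

type_synonym index = "nat \<times> (nat \<times> nat) list \<times> nat"

definition index_set :: "nat \<Rightarrow> index set" where
  "index_set n = {(i0, ps, q).
     i0 \<ge> 1 \<and> (\<forall>(i, k) \<in> set ps. i \<ge> 1 \<and> k \<ge> 1) \<and>
     distinct_adj (map fst ps) \<and>
     (ps \<noteq> [] \<longrightarrow> fst (last ps) \<noteq> 1) \<and>
     i0 + (\<Sum>(i, k) \<leftarrow> ps. k * i) + 2 * q = n}"

fun gword :: "index \<Rightarrow> lmap" where
  "gword (i0, ps, q) = tens_list
     (gmap' i0 # concat (map (\<lambda>(i, k). replicate k (gmap i)) ps) @ replicate (2 * q) (gmap 1))"

fun hword :: "index \<Rightarrow> lmap" where
  "hword (i0, ps, q) = tens_list
     (replicate (2 * q) (hmap 1) @ concat (map (\<lambda>(i, k). replicate k (hmap i)) (rev ps)) @ [hmap' i0])"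


section \<open>Sanity checks\<close>

lemma e_append: "e (u @ v) = e u * e v"
  by (simp add: e_def Poly_Mapping.mult_single plus_list_def)

lemma scal_1: "scal 1 = 1"
  by (simp add: scal_def flip: zero_list_def)

lemma scal_0: "scal 0 = 0"
  by (simp add: scal_def)

lemma scal_add: "scal (a + b) = scal a + scal b"
  by (simp add: scal_def single_add)

lemma scal_mult: "scal (a * b) = scal a * scal b"
  by (simp add: scal_def Poly_Mapping.mult_single plus_list_def)

lemma scale_e: "c *\<^sub>k e w = Poly_Mapping.single w c"
  by (simp add: scale_def scal_def e_def Poly_Mapping.mult_single plus_list_def)

lemma sum_monomials:
  fixes x :: tensor
  shows "(\<Sum>w \<in> Poly_Mapping.keys x. Poly_Mapping.single w (Poly_Mapping.lookup x w)) = x"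
  by (rule poly_mapping_eqI) (auto simp: lookup_sum lookup_single when_def in_keys_iff)

lemma tensor_expansion:
  "x = (\<Sum>w \<in> Poly_Mapping.keys x. Poly_Mapping.lookup x w *\<^sub>k e w)"
  by (simp add: scale_e sum_monomials)

lemma lin_superset:
  assumes "finite A" "Poly_Mapping.keys x \<subseteq> A"
  shows "lin \<phi> x = (\<Sum>w \<in> A. Poly_Mapping.lookup x w *\<^sub>k \<phi> w)"
  unfolding lin_def using assms
  by (intro sum.mono_neutral_left) (auto simp: scale_def scal_0 in_keys_iff)

lemma lin_add: "lin \<phi> (x + y) = lin \<phi> x + lin \<phi> y"
proof -
  let ?A = "Poly_Mapping.keys x \<union> Poly_Mapping.keys y"
  have "Poly_Mapping.keys (x + y) \<subseteq> ?A"
    by (rule Poly_Mapping.keys_add)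
  then show ?thesis
    by (simp add: lin_superset[of ?A] lookup_add scale_def scal_add distrib_right sum.distrib)
qed

lemma lin_e: "lin \<phi> (e w) = \<phi> w"
  by (simp add: lin_def e_def scale_def scal_1)

lemma lin_single: "lin \<phi> (Poly_Mapping.single w c) = c *\<^sub>k \<phi> w"
  by (cases "c = 0") (simp_all add: lin_def scale_def scal_0)

lemma tensor_induct [case_names zero single add]:
  fixes x :: tensor
  assumes "P 0" "\<And>w c. P (Poly_Mapping.single w c)" "\<And>x y. P x \<Longrightarrow> P y \<Longrightarrow> P (x + y)"
  shows "P x"
proof -
  have "P (\<Sum>w \<in> A. Poly_Mapping.single w (Poly_Mapping.lookup x w))" if "finite A" for A
    using that by induction (auto intro: assms)
  from this[of "Poly_Mapping.keys x"] show ?thesis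
    by (simp add: sum_monomials)
qed

lemma lin_scale: "lin \<phi> (c *\<^sub>k x) = c *\<^sub>k lin \<phi> x"
proof (induction x rule: tensor_induct)
  case zero
  show ?case by (simp add: scale_def lin_def)
next
  case (single w d)
  have "c *\<^sub>k Poly_Mapping.single w d = Poly_Mapping.single w (c * d)"
    by (simp add: scale_def scal_def Poly_Mapping.mult_single plus_list_def)
  then show ?case by (simp add: lin_single) (simp add: scale_def scal_mult mult.assoc)
next
  case (add x y)
  have "c *\<^sub>k (x + y) = c *\<^sub>k x + c *\<^sub>k y" for x y
    by (simp add: scale_def distrib_left)
  with add show ?case by (simp add: lin_add)
qed

lemma scal_commute: "x * scal c = scal c * x"
proof (induction x rule: tensor_induct)
  case (single w d)
  show ?case by (simp add: scal_def Poly_Mapping.mult_single plus_list_def mult.commute)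
qed (simp_all add: distrib_left distrib_right)

lemma is_hom_zero: "is_hom f \<Longrightarrow> app f 0 = 0"
  unfolding is_hom_def by (metis add_cancel_right_right)

lemma is_hom_expand:
  assumes "is_hom f"
  shows "app f x = (\<Sum>w \<in> Poly_Mapping.keys x. Poly_Mapping.lookup x w *\<^sub>k app f (e w))"
proof -
  have "app f x = lin (\<lambda>w. app f (e w)) x"
  proof (induction x rule: tensor_induct)
    case zero
    show ?case by (simp add: lin_def is_hom_zero[OF assms])
  next
    case (single w c)
    show ?case
      using assms by (simp add: is_hom_def lin_scale lin_e flip: scale_e)
  next
    case (add x y)
    then show ?case using assms by (simp add: lin_add is_hom_def)
  qed
  then show ?thesis by (simp add: lin_def)
qed

lemma lin_sum: "lin \<phi> (\<Sum>a \<in> A. F a) = (\<Sum>a \<in> A. lin \<phi> (F a))"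
  by (induction A rule: infinite_finite_induct) (simp_all add: lin_add, simp_all add: lin_def)

text \<open>The defining property of the tensor product of linear maps.\<close>

lemma tens_apply:
  assumes "is_hom f" "is_hom g" "x \<in> tpower (src f)"
  shows "app (f \<otimes>\<^sub>m g) (x * y) = app f x * app g y"
proof -
  let ?\<phi> = "\<lambda>w. app f (e (take (src f) w)) * app g (e (drop (src f) w))"
  let ?X = "Poly_Mapping.keys x" and ?Y = "Poly_Mapping.keys y"
  let ?x = "Poly_Mapping.lookup x" and ?y = "Poly_Mapping.lookup y"
  have "lin ?\<phi> (x * y) = lin ?\<phi> ((\<Sum>u\<in>?X. ?x u *\<^sub>k e u) * (\<Sum>v\<in>?Y. ?y v *\<^sub>k e v))"
    by (simp flip: tensor_expansion)
  also have "\<dots> = (\<Sum>u\<in>?X. \<Sum>v\<in>?Y. lin ?\<phi> (Poly_Mapping.single (u @ v) (?x u * ?y v)))"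
    by (simp add: sum_product lin_sum scale_e Poly_Mapping.mult_single plus_list_def)
  also have "\<dots> = (\<Sum>u\<in>?X. \<Sum>v\<in>?Y. (?x u *\<^sub>k app f (e u)) * (?y v *\<^sub>k app g (e v)))"
  proof (intro sum.cong refl)
    fix u v assume "u \<in> ?X"
    then have "length u = src f" using assms by (auto simp: tpower_def)
    then have "lin ?\<phi> (Poly_Mapping.single (u @ v) (?x u * ?y v))
        = scal (?x u) * (scal (?y v) * app f (e u)) * app g (e v)"
      by (simp add: lin_single scale_def scal_mult mult.assoc)
    also have "scal (?y v) * app f (e u) = app f (e u) * scal (?y v)"
      by (rule scal_commute[symmetric])
    finally show "lin ?\<phi> (Poly_Mapping.single (u @ v) (?x u * ?y v))
        = (?x u *\<^sub>k app f (e u)) * (?y v *\<^sub>k app g (e v))"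
      by (simp add: scale_def mult.assoc)
  qed
  also have "\<dots> = app f x * app g y"
    by (simp add: is_hom_expand[OF assms(1), of x] is_hom_expand[OF assms(2), of y] sum_product)
  finally show ?thesis by (simp add: tens_def)
qed

lemma tpower_add: "x \<in> tpower n \<Longrightarrow> y \<in> tpower n \<Longrightarrow> x + y \<in> tpower n"
  using Poly_Mapping.keys_add[of x y] by (auto simp: tpower_def)

lemma tpower_0: "0 \<in> tpower n"
  by (simp add: tpower_def)

lemma tpower_minus: "x \<in> tpower n \<Longrightarrow> y \<in> tpower n \<Longrightarrow> x - y \<in> tpower n"
  by (auto simp: tpower_def in_keys_iff lookup_minus)

lemma tpower_mult:
  assumes "x \<in> tpower m" "y \<in> tpower n"
  shows "x * y \<in> tpower (m + n)"
  using Poly_Mapping.keys_mult[of x y] assms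
  by (auto simp: tpower_def plus_list_def)

lemma tpower_e: "e w \<in> tpower n \<longleftrightarrow> length w = n"
  by (simp add: tpower_def e_def)

lemma tpower_scal: "scal c \<in> tpower 0"
  by (simp add: tpower_def scal_def)

lemma tpower_scale: "x \<in> tpower n \<Longrightarrow> c *\<^sub>k x \<in> tpower n"
  using tpower_mult[OF tpower_scal] by (simp add: scale_def)

lemma tpower_sum: "(\<And>a. a \<in> A \<Longrightarrow> F a \<in> tpower n) \<Longrightarrow> sum F A \<in> tpower n"
  by (induction A rule: infinite_finite_induct) (auto simp: tpower_0 tpower_add)

lemma is_hom_lin:
  assumes "\<And>w. length w = m \<Longrightarrow> \<phi> w \<in> tpower n"
  shows "is_hom (LMap m n (lin \<phi>))"
proof -
  have "lin \<phi> x \<in> tpower n" if "x \<in> tpower m" for x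
    unfolding lin_def using assms that
    by (intro tpower_sum tpower_scale) (auto simp: tpower_def[of m])
  then show ?thesis
    by (simp add: is_hom_def lin_add lin_scale)
qed

lemma is_hom_tens:
  assumes "is_hom f" "is_hom g"
  shows "is_hom (f \<otimes>\<^sub>m g)"
  unfolding tens_def using assms
  by (intro is_hom_lin tpower_mult) (auto simp: is_hom_def tpower_e)

lemma is_hom_idm: "is_hom (idm n)"
  by (simp add: is_hom_def idm_def)

lemma is_hom_compose: "is_hom f \<Longrightarrow> is_hom g \<Longrightarrow> src f = tgt g \<Longrightarrow> is_hom (f \<circ>\<^sub>m g)"
  by (simp add: is_hom_def compose_def)

lemma is_hom_structure_maps:
  "is_hom R_map" "is_hom mu_map" "is_hom alpha_map" "is_hom beta_map"
  "is_hom xi_map" "is_hom zeta_map" "is_hom lambda_l_map" "is_hom lambda_r_map"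
proof -
  note tp = tpower_0 tpower_add tpower_minus tpower_scale tpower_scal tpower_e
  have "length w = 2 \<Longrightarrow> R_basis w \<in> tpower 2" for w
    by (cases w rule: R_basis.cases) (auto simp: tp)
  then show "is_hom R_map" unfolding R_map_def by (rule is_hom_lin)
  have "length w = 1 \<Longrightarrow> mu_basis w \<in> tpower 0" for w
    by (cases w rule: mu_basis.cases) (auto simp: tp)
  then show "is_hom mu_map" unfolding mu_map_def by (rule is_hom_lin)
  have "length w = 2 \<Longrightarrow> alpha_basis w \<in> tpower 0" for w
    by (cases w rule: alpha_basis.cases) (auto simp: tp)
  then show "is_hom alpha_map" unfolding alpha_map_def by (rule is_hom_lin)
  have "length w = 0 \<Longrightarrow> beta_basis w \<in> tpower 2" for w
    by (cases w rule: beta_basis.cases) (auto simp: tp)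
  then show "is_hom beta_map" unfolding beta_map_def by (rule is_hom_lin)
  have "length w = 1 \<Longrightarrow> xi_basis w \<in> tpower 1" for w
    by (cases w rule: xi_basis.cases) (auto simp: tp)
  then show "is_hom xi_map" unfolding xi_map_def by (rule is_hom_lin)
  have "length w = 1 \<Longrightarrow> zeta_basis w \<in> tpower 1" for w
    by (cases w rule: zeta_basis.cases) (auto simp: tp)
  then show "is_hom zeta_map" unfolding zeta_map_def by (rule is_hom_lin)
  have "length w = 0 \<Longrightarrow> lambda_l_basis w \<in> tpower 1" for w
    by (cases w rule: lambda_l_basis.cases) (auto simp: tp)
  then show "is_hom lambda_l_map" unfolding lambda_l_map_def by (rule is_hom_lin)
  have "length w = 0 \<Longrightarrow> lambda_r_basis w \<in> tpower 1" for w
    by (cases w rule: lambda_r_basis.cases) (auto simp: tp)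
  then show "is_hom lambda_r_map" unfolding lambda_r_map_def by (rule is_hom_lin)
qed

lemma index_list_bounds:
  fixes ps :: "(nat \<times> nat) list"
  assumes "\<forall>(i, k) \<in> set ps. i \<ge> 1 \<and> k \<ge> 1"
  shows "length ps \<le> (\<Sum>(i, k) \<leftarrow> ps. k * i)"
    and "(i, k) \<in> set ps \<Longrightarrow> i \<le> (\<Sum>(i, k) \<leftarrow> ps. k * i) \<and> k \<le> (\<Sum>(i, k) \<leftarrow> ps. k * i)"
proof -
  show "length ps \<le> (\<Sum>(i, k) \<leftarrow> ps. k * i)"
    using assms
  proof (induction ps)
    case (Cons p ps)
    then have "(case p of (i, k) \<Rightarrow> k * i) \<ge> 1" by (cases p) auto
    with Cons show ?case by simp
  qed simp
next
  assume *: "(i, k) \<in> set ps"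
  then have "k * i \<le> (\<Sum>(i, k) \<leftarrow> ps. k * i)"
    by (intro member_le_sum_list) (force, simp)
  moreover have "i \<le> k * i" "k \<le> k * i" using * assms by auto
  ultimately show "i \<le> (\<Sum>(i, k) \<leftarrow> ps. k * i) \<and> k \<le> (\<Sum>(i, k) \<leftarrow> ps. k * i)"
    by linarith
qed

lemma finite_index_set: "finite (index_set n)"
proof (rule finite_subset)
  let ?P = "{ps. set ps \<subseteq> {..n} \<times> {..n} \<and> length ps \<le> n}"
  show "index_set n \<subseteq> {..n} \<times> ?P \<times> {..n}"
  proof
    fix s assume s: "s \<in> index_set n"
    obtain i0 ps q where [simp]: "s = (i0, ps, q)" by (cases s)
    let ?s = "\<Sum>(i, k) \<leftarrow> ps. k * i"
    have pos: "\<forall>(i, k) \<in> set ps. i \<ge> 1 \<and> k \<ge> 1" and n: "i0 + ?s + 2 * q = n"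
      using s by (simp_all add: index_set_def)
    have "i \<le> n \<and> k \<le> n" if "(i, k) \<in> set ps" for i k
      using index_list_bounds(2)[OF pos that] n by linarith
    then have "set ps \<subseteq> {..n} \<times> {..n}" by auto
    moreover have "length ps \<le> n" "i0 \<le> n" "q \<le> n"
      using index_list_bounds(1)[OF pos] n by linarith+
    ultimately show "s \<in> {..n} \<times> ?P \<times> {..n}" by simp
  qed
  show "finite ({..n} \<times> ?P \<times> {..n})"
    by (intro finite_cartesian_product finite_lists_length_le) auto
qed

end

(* Write R = 1 + beta alpha. In d_left n n = (d_left (n-1) (n-1) (x) 1) R_(n-1), the summand 1 of R
   appends a block g_1 to a word in the generators, and beta alpha turns the last block g_m into
   g_(m+1), because (alpha (x) 1)(1 (x) beta) = xi and mu applied to beta gives lambda_l. Hence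
   d_left n n is the sum of the words of all compositions of n. Since d_left i n is
   d_left i (n-1) (x) 1 for i < n, the alternating sum telescopes to the compositions with an
   even number of trailing ones, and these are encoded by the index set via run lengths.
   Reversing words and exchanging e_1 and e_2 is an anti-automorphism of the tensor algebra that
   fixes R, mu, alpha, beta and exchanges xi with zeta and lambda_l with lambda_r; it carries
   the left differential to the right one. *)

theory Submission
  imports Defs
begin

no_notation map_comp (infixl \<open>\<circ>\<^sub>m\<close> 55)

section \<open>Linear maps determined by basis words\<close>

text \<open>A condition on bare functions, free of source and target, so that sums, differences and
  signed combinations of maps can be compared directly.\<close>

definition k_linear :: "(tensor \<Rightarrow> tensor) \<Rightarrow> bool" where
  "k_linear F \<longleftrightarrow> (\<forall>x y. F (x + y) = F x + F y) \<and> (\<forall>c x. F (c *\<^sub>k x) = c *\<^sub>k F x)"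

lemma k_linear_hom: "is_hom f \<Longrightarrow> k_linear (app f)"
  by (simp add: k_linear_def is_hom_def)

lemma k_linear_lin: "k_linear (lin \<phi>)"
  by (simp add: k_linear_def lin_add lin_scale)

lemma k_linear_add: "k_linear F \<Longrightarrow> F (x + y) = F x + F y"
  by (simp add: k_linear_def)

lemma k_linear_scal: "k_linear F \<Longrightarrow> F (scal c * x) = scal c * F x"
  by (simp add: k_linear_def scale_def)

lemma k_linear_zero: "k_linear F \<Longrightarrow> F 0 = 0"
  using k_linear_scal[of F 0 0] by (simp add: scal_0)

lemma k_linear_minus: "k_linear F \<Longrightarrow> F (- x) = - F x"
  using k_linear_add[of F x "- x"] by (simp add: k_linear_zero eq_neg_iff_add_eq_0 add.commute)

lemma k_linear_diff: "k_linear F \<Longrightarrow> F (x - y) = F x - F y"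
  using k_linear_add[of F x "- y"] by (simp add: k_linear_minus)

lemma k_linear_sum: "k_linear F \<Longrightarrow> F (\<Sum>a\<in>A. f a) = (\<Sum>a\<in>A. F (f a))"
  by (induction A rule: infinite_finite_induct) (simp_all add: k_linear_zero k_linear_add)

lemma k_linear_sign: "k_linear F \<Longrightarrow> F ((- 1) ^ i * x) = (- 1) ^ i * F x"
  by (cases "even i") (simp_all add: k_linear_minus)

lemmas k_linear_simps = k_linear_add k_linear_scal k_linear_zero k_linear_minus k_linear_diff
  k_linear_sum k_linear_sign

lemma k_linearI:
  assumes "\<And>x y. F (x + y) = F x + F y" "\<And>c x. F (scal c * x) = scal c * F x"
  shows "k_linear F"
  using assms by (simp add: k_linear_def scale_def)

lemma k_linear_fun_uminus: "k_linear F \<Longrightarrow> k_linear (\<lambda>x. - F x)"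
  by (intro k_linearI) (simp_all add: k_linear_simps)

lemma k_linear_fun_add: "k_linear F \<Longrightarrow> k_linear G \<Longrightarrow> k_linear (\<lambda>x. F x + G x)"
  by (intro k_linearI) (simp_all add: k_linear_simps algebra_simps)

lemma k_linear_fun_diff: "k_linear F \<Longrightarrow> k_linear G \<Longrightarrow> k_linear (\<lambda>x. F x - G x)"
  by (intro k_linearI) (simp_all add: k_linear_simps right_diff_distrib)

lemma k_linear_fun_sum: "(\<And>a. a \<in> A \<Longrightarrow> k_linear (F a)) \<Longrightarrow> k_linear (\<lambda>x. \<Sum>a\<in>A. F a x)"
  by (intro k_linearI) (simp_all add: k_linear_simps sum.distrib sum_distrib_left)

lemma k_linear_fun_sign: "k_linear F \<Longrightarrow> k_linear (\<lambda>x. (- 1) ^ i * F x)"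
  by (cases "even i") (simp_all add: k_linear_fun_uminus)

lemma k_linear_expand:
  assumes "k_linear F"
  shows "F x = (\<Sum>w\<in>Poly_Mapping.keys x. Poly_Mapping.lookup x w *\<^sub>k F (e w))"
  using assms by (subst tensor_expansion[of x]) (simp add: k_linear_simps scale_def)

text \<open>All keys of an element of \<open>tpower n\<close> have length \<open>n\<close>, so words
  of other lengths never enter its expansion.\<close>

lemma k_linear_eqI:
  assumes "k_linear F" "k_linear G" "\<And>w. length w = n \<Longrightarrow> F (e w) = G (e w)" "x \<in> tpower n"
  shows "F x = G x"
  using assms by (simp add: k_linear_expand[of F x] k_linear_expand[of G x] tpower_def)

lemma k_linear_ext:
  assumes "k_linear F" "k_linear G" "\<And>w. F (e w) = G (e w)"
  shows "F x = G x"
  using assms by (simp add: k_linear_expand[of F x] k_linear_expand[of G x])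

text \<open>Equality of \<open>lmap\<close> values is too fine: the underlying functions also have
  values outside the source degree, and two descriptions of one map may differ there.\<close>

definition lmap_eqv :: "lmap \<Rightarrow> lmap \<Rightarrow> bool" (infix \<open>\<approx>\<close> 50) where
  "f \<approx> g \<longleftrightarrow> src f = src g \<and> tgt f = tgt g \<and>
     (\<forall>w. length w = src f \<longrightarrow> app f (e w) = app g (e w))"

lemma eqv_refl [simp]: "f \<approx> f"
  by (simp add: lmap_eqv_def)

lemma eqv_sym: "f \<approx> g \<Longrightarrow> g \<approx> f"
  by (simp add: lmap_eqv_def)

lemma eqv_trans [trans]: "f \<approx> g \<Longrightarrow> g \<approx> h \<Longrightarrow> f \<approx> h"
  by (simp add: lmap_eqv_def)

lemma eqv_app_e: "f \<approx> g \<Longrightarrow> length w = src f \<Longrightarrow> app f (e w) = app g (e w)"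
  by (simp add: lmap_eqv_def)

lemma eqv_app: "f \<approx> g \<Longrightarrow> is_hom f \<Longrightarrow> is_hom g \<Longrightarrow> x \<in> tpower (src f) \<Longrightarrow> app f x = app g x"
  by (rule k_linear_eqI[of _ _ "src f"]) (auto simp: k_linear_hom lmap_eqv_def)

section \<open>Laws of tensor products and composition of maps\<close>

lemma src_tgt_simps [simp]:
  "src (f \<otimes>\<^sub>m g) = src f + src g" "tgt (f \<otimes>\<^sub>m g) = tgt f + tgt g"
  "src (f \<circ>\<^sub>m g) = src g" "tgt (f \<circ>\<^sub>m g) = tgt f"
  "src (idm n) = n" "tgt (idm n) = n"
  by (simp_all add: tens_def compose_def idm_def)

lemma app_idm [simp]: "app (idm n) x = x"
  by (simp add: idm_def)

lemma app_compose [simp]: "app (f \<circ>\<^sub>m g) x = app f (app g x)"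
  by (simp add: compose_def)

lemma app_tens_e:
  "app (f \<otimes>\<^sub>m g) (e w) = app f (e (take (src f) w)) * app g (e (drop (src f) w))"
  by (simp add: tens_def lin_e)

lemma app_tens_append:
  "length u = src f \<Longrightarrow> app (f \<otimes>\<^sub>m g) (e (u @ v)) = app f (e u) * app g (e v)"
  by (simp add: app_tens_e)

lemma k_linear_tens: "k_linear (app (f \<otimes>\<^sub>m g))"
  by (simp add: tens_def k_linear_lin)

lemma e_Nil: "e [] = 1"
  by (simp add: e_def flip: zero_list_def)

text \<open>A genuine equality: both bracketings cut every word at the same two places, whatever its
  length.\<close>

lemma tens_assoc: "(f \<otimes>\<^sub>m g) \<otimes>\<^sub>m h = f \<otimes>\<^sub>m g \<otimes>\<^sub>m h"
  by (simp add: tens_def lin_e drop_take add.commute mult.assoc)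

lemma tens_cong: "f \<approx> f' \<Longrightarrow> g \<approx> g' \<Longrightarrow> f \<otimes>\<^sub>m g \<approx> f' \<otimes>\<^sub>m g'"
  by (simp add: lmap_eqv_def app_tens_e)

text \<open>Only an equivalence, since the underlying identity function of \<open>idm 0\<close>
  copies whatever is left of a word longer than \<open>src f\<close>.\<close>

lemma tens_idm_0_right: "f \<otimes>\<^sub>m idm 0 \<approx> f"
  by (simp add: lmap_eqv_def app_tens_e e_Nil)

text \<open>Here equality holds: cutting off an empty prefix leaves every word intact, and linearity
  identifies \<open>f\<close> with its extension from words.\<close>

lemma tens_idm_0_left: "k_linear (app f) \<Longrightarrow> idm 0 \<otimes>\<^sub>m f = f"
proof (cases f)
  case (LMap m n F)
  assume "k_linear (app f)"
  then have "lin (\<lambda>w. F (e w)) x = F x" for x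
    using LMap by (subst (2) tensor_expansion) (simp add: lin_def k_linear_simps scale_def)
  then show ?thesis
    using LMap by (simp add: tens_def e_Nil idm_def fun_eq_iff)
qed

lemma idm_tens_idm: "idm m \<otimes>\<^sub>m idm n \<approx> idm (m + n)"
  by (simp add: lmap_eqv_def app_tens_e flip: e_append)

text \<open>Equivalence speaks of words only; the homomorphism property carries it over to the
  tensor \<open>app g (e w)\<close>.\<close>

lemma compose_cong:
  assumes "f \<approx> f'" "g \<approx> g'" "is_hom f" "is_hom f'" "is_hom g" "tgt g = src f"
  shows "f \<circ>\<^sub>m g \<approx> f' \<circ>\<^sub>m g'"
proof -
  have "app f (app g (e w)) = app f' (app g' (e w))" if "length w = src g" for w
  proof -
    have "app g (e w) = app g' (e w)"
      using assms(2) that by (rule eqv_app_e)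
    moreover have "app g (e w) \<in> tpower (src f)"
      using assms(5,6) that by (simp add: is_hom_def tpower_e)
    ultimately show ?thesis using assms eqv_app[of f f'] by metis
  qed
  with assms show ?thesis by (simp add: lmap_eqv_def)
qed

lemma compose_tens_idm:
  assumes "is_hom f" "is_hom g" "tgt g = src f"
  shows "(f \<circ>\<^sub>m g) \<otimes>\<^sub>m idm n \<approx> (f \<otimes>\<^sub>m idm n) \<circ>\<^sub>m (g \<otimes>\<^sub>m idm n)"
proof -
  have "app (f \<otimes>\<^sub>m idm n) (app g (e u) * e v) = app f (app g (e u)) * e v"
    if "length u = src g" for u v
  proof -
    have "app g (e u) \<in> tpower (src f)"
      using assms(2,3) that by (auto simp: is_hom_def tpower_e)
    then show ?thesis
      using assms(1) by (simp add: tens_apply is_hom_idm)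
  qed
  then show ?thesis by (simp add: lmap_eqv_def app_tens_e)
qed

lemma tens_list_Nil [simp]: "tens_list [] = idm 0"
  by (simp add: tens_list_def)

lemma tens_list_Cons [simp]: "tens_list (f # fs) = f \<otimes>\<^sub>m tens_list fs"
  by (simp add: tens_list_def)

lemma k_linear_tens_list: "k_linear (app (tens_list fs))"
  by (cases fs) (simp_all add: k_linear_tens k_linear_hom is_hom_idm)

lemma tens_list_append: "tens_list (fs @ gs) = tens_list fs \<otimes>\<^sub>m tens_list gs"
  by (induction fs) (simp_all add: tens_idm_0_left k_linear_tens_list tens_assoc)

lemma tens_list_snoc: "tens_list (fs @ [f]) \<approx> tens_list fs \<otimes>\<^sub>m f"
  by (simp add: tens_list_append tens_cong tens_idm_0_right)

lemma is_hom_tens_list: "(\<And>f. f \<in> set fs \<Longrightarrow> is_hom f) \<Longrightarrow> is_hom (tens_list fs)"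
  by (induction fs) (auto intro: is_hom_tens is_hom_idm)

section \<open>Sources, targets and values of the structure maps\<close>

lemma structure_src_tgt [simp]:
  "src R_map = 2" "tgt R_map = 2" "src mu_map = 1" "tgt mu_map = 0"
  "src alpha_map = 2" "tgt alpha_map = 0" "src beta_map = 0" "tgt beta_map = 2"
  "src xi_map = 1" "tgt xi_map = 1" "src zeta_map = 1" "tgt zeta_map = 1"
  "src lambda_l_map = 0" "tgt lambda_l_map = 1" "src lambda_r_map = 0" "tgt lambda_r_map = 1"
  by (simp_all add: R_map_def mu_map_def alpha_map_def beta_map_def xi_map_def zeta_map_def
      lambda_l_map_def lambda_r_map_def)

lemma structure_app_e [simp]:
  "app R_map (e w) = R_basis w" "app mu_map (e w) = mu_basis w"
  "app alpha_map (e w) = alpha_basis w" "app beta_map (e w) = beta_basis w"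
  "app xi_map (e w) = xi_basis w" "app zeta_map (e w) = zeta_basis w"
  "app lambda_l_map (e w) = lambda_l_basis w" "app lambda_r_map (e w) = lambda_r_basis w"
  by (simp_all add: R_map_def mu_map_def alpha_map_def beta_map_def xi_map_def zeta_map_def
      lambda_l_map_def lambda_r_map_def lin_e)

lemma structure_app_1 [simp]:
  "app beta_map 1 = beta_basis []" "app lambda_l_map 1 = lambda_l_basis []"
  by (simp_all flip: e_Nil)

lemma src_tgt_tens_list_replicate [simp]:
  "src (tens_list (replicate k f)) = k * src f" "tgt (tens_list (replicate k f)) = k * tgt f"
  by (induction k) simp_all

lemma is_hom_generators: "is_hom (gmap m)" "is_hom (gmap' m)" "is_hom (hmap m)" "is_hom (hmap' m)"
  by (auto simp: gmap_def gmap'_def hmap_def hmap'_def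
      intro!: is_hom_tens is_hom_tens_list is_hom_idm is_hom_structure_maps)

lemma is_hom_words: "is_hom (gword s)" "is_hom (hword s)"
  by (cases s; simp only: gword.simps hword.simps, rule is_hom_tens_list,
      force simp: is_hom_generators)+


section \<open>The differentials\<close>

abbreviation comp_list :: "lmap list \<Rightarrow> nat \<Rightarrow> lmap" where
  "comp_list fs n \<equiv> foldr (\<circ>\<^sub>m) fs (idm n)"

lemma comp_list_hom:
  assumes "\<And>f. f \<in> set fs \<Longrightarrow> is_hom f \<and> src f = n \<and> tgt f = n"
  shows "is_hom (comp_list fs n) \<and> src (comp_list fs n) = n \<and> tgt (comp_list fs n) = n"
  using assms by (induction fs) (auto intro: is_hom_idm is_hom_compose)

lemma comp_list_cong:
  assumes "list_all2 (\<approx>) fs gs"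
    and "\<And>f. f \<in> set fs \<union> set gs \<Longrightarrow> is_hom f \<and> src f = n \<and> tgt f = n"
  shows "comp_list fs n \<approx> comp_list gs n"
  using assms
proof (induction rule: list_all2_induct)
  case (Cons f fs g gs)
  then have "comp_list fs n \<approx> comp_list gs n" by simp
  moreover have "is_hom (comp_list fs n) \<and> src (comp_list fs n) = n \<and> tgt (comp_list fs n) = n"
    by (rule comp_list_hom) (simp add: Cons.prems)
  moreover have "is_hom f" "is_hom g" "src f = n"
    by (simp_all add: Cons.prems)
  ultimately show ?case
    using Cons.hyps(1) by (simp add: compose_cong)
qed simp

lemma R_at_hom:
  assumes "1 \<le> p" "p < n"
  shows "is_hom (R_at p n)" "src (R_at p n) = n" "tgt (R_at p n) = n"
  using assms by (auto simp: R_at_def intro!: is_hom_tens is_hom_idm is_hom_structure_maps)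

lemma d_left_hom:
  assumes "1 \<le> i" "i \<le> n"
  shows "is_hom (d_left i n)" "src (d_left i n) = n" "tgt (d_left i n) = n - 1"
proof -
  have "is_hom f \<and> src f = n \<and> tgt f = n"
    if "f \<in> set (map (\<lambda>p. R_at p n) [1..<i])" for f
    using that assms by (auto simp: R_at_hom)
  note this[THEN comp_list_hom]
  then show "is_hom (d_left i n)" "src (d_left i n) = n" "tgt (d_left i n) = n - 1"
    using assms
    by (auto simp: d_left_def simp del: set_map One_nat_def
        intro!: is_hom_compose is_hom_tens is_hom_idm is_hom_structure_maps)
qed

lemma d_right_hom:
  assumes "1 \<le> i" "i \<le> n"
  shows "is_hom (d_right i n)" "src (d_right i n) = n" "tgt (d_right i n) = n - 1"
proof -
  have "is_hom f \<and> src f = n \<and> tgt f = n"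
    if "f \<in> set (map (\<lambda>p. R_at p n) (rev [i..<n]))" for f
    using that assms by (auto simp: R_at_hom)
  note this[THEN comp_list_hom]
  then show "is_hom (d_right i n)" "src (d_right i n) = n" "tgt (d_right i n) = n - 1"
    using assms
    by (auto simp: d_right_def simp del: set_map One_nat_def
        intro!: is_hom_compose is_hom_tens is_hom_idm is_hom_structure_maps)
qed

lemma R_at_Suc:
  assumes "1 \<le> p" "p < n"
  shows "R_at p (Suc n) \<approx> R_at p n \<otimes>\<^sub>m idm 1"
proof -
  \<comment> \<open>Subtraction is truncated, so \<open>p < n\<close> is what makes room for
    splitting off one identity factor.\<close>
  have "idm (Suc n - p - 1) \<approx> idm (n - p - 1) \<otimes>\<^sub>m idm 1"
    using idm_tens_idm[of "n - p - 1" 1] assms by (simp add: eqv_sym Suc_diff_Suc)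
  then show ?thesis
    by (simp add: R_at_def tens_assoc tens_cong)
qed

lemma comp_list_tens_idm:
  assumes "\<And>f. f \<in> set fs \<Longrightarrow> is_hom f \<and> src f = n \<and> tgt f = n"
  shows "comp_list fs n \<otimes>\<^sub>m idm 1 \<approx> comp_list (map (\<lambda>f. f \<otimes>\<^sub>m idm 1) fs) (Suc n)"
  using assms
proof (induction fs)
  case Nil
  show ?case using idm_tens_idm[of n 1] by simp
next
  case (Cons f fs)
  note h = comp_list_hom[of fs n]
  have "comp_list (f # fs) n \<otimes>\<^sub>m idm 1 \<approx> (f \<otimes>\<^sub>m idm 1) \<circ>\<^sub>m (comp_list fs n \<otimes>\<^sub>m idm 1)"
    using Cons.prems h by (simp add: compose_tens_idm)
  also have "\<dots> \<approx> (f \<otimes>\<^sub>m idm 1) \<circ>\<^sub>m comp_list (map (\<lambda>f. f \<otimes>\<^sub>m idm 1) fs) (Suc n)"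
    using Cons h by (intro compose_cong) (auto simp: is_hom_tens is_hom_idm)
  finally show ?case by simp
qed

text \<open>The operators \<open>R_at p\<close> with \<open>p < i\<close> and \<mu> act on the first
  \<open>i\<close> factors only; as \<open>i \<le> n\<close>, the last of the \<open>Suc n\<close>
  factors is untouched.\<close>

lemma d_left_Suc:
  assumes "1 \<le> i" "i \<le> n"
  shows "d_left i (Suc n) \<approx> d_left i n \<otimes>\<^sub>m idm 1"
proof -
  let ?fs = "map (\<lambda>p. R_at p n) [1..<i]"
  let ?gs = "map (\<lambda>p. R_at p (Suc n)) [1..<i]"
  let ?ts = "map (\<lambda>f. f \<otimes>\<^sub>m idm 1) ?fs"
  have fs: "is_hom f \<and> src f = n \<and> tgt f = n" if "f \<in> set ?fs" for f
    using that assms by (auto simp: R_at_hom)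
  have gs: "is_hom f \<and> src f = Suc n \<and> tgt f = Suc n" if "f \<in> set ?gs" for f
    using that assms by (auto simp: R_at_hom)
  have ts: "is_hom f \<and> src f = Suc n \<and> tgt f = Suc n" if "f \<in> set ?ts" for f
    using that assms by (auto simp: R_at_hom is_hom_tens is_hom_idm)
  have "list_all2 (\<approx>) ?gs ?ts"
    using assms by (auto simp: list_all2_conv_all_nth simp del: upt_Suc
        intro!: R_at_Suc[unfolded One_nat_def])
  then have "comp_list ?gs (Suc n) \<approx> comp_list ?ts (Suc n)"
    using gs ts by (intro comp_list_cong) auto
  also have "\<dots> \<approx> comp_list ?fs n \<otimes>\<^sub>m idm 1"
    by (rule eqv_sym, rule comp_list_tens_idm) (rule fs)
  finally have 1: "comp_list ?gs (Suc n) \<approx> comp_list ?fs n \<otimes>\<^sub>m idm 1" .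
  have "idm n \<approx> idm (n - 1) \<otimes>\<^sub>m idm 1"
    using idm_tens_idm[of "n - 1" 1] assms by (simp add: eqv_sym)
  then have 2: "mu_map \<otimes>\<^sub>m idm n \<approx> (mu_map \<otimes>\<^sub>m idm (n - 1)) \<otimes>\<^sub>m idm 1"
    by (simp add: tens_assoc tens_cong)
  have mu: "is_hom (mu_map \<otimes>\<^sub>m idm m)" for m
    by (intro is_hom_tens is_hom_idm is_hom_structure_maps)
  have hs: "is_hom (comp_list ?fs n) \<and> src (comp_list ?fs n) = n \<and> tgt (comp_list ?fs n) = n"
      "is_hom (comp_list ?gs (Suc n)) \<and> src (comp_list ?gs (Suc n)) = Suc n \<and>
        tgt (comp_list ?gs (Suc n)) = Suc n"
    by (rule comp_list_hom, rule fs, assumption) (rule comp_list_hom, rule gs, assumption)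
  have "d_left i (Suc n) \<approx> ((mu_map \<otimes>\<^sub>m idm (n - 1)) \<otimes>\<^sub>m idm 1) \<circ>\<^sub>m (comp_list ?fs n \<otimes>\<^sub>m idm 1)"
    unfolding d_left_def diff_Suc_1
  proof (rule compose_cong[OF 2 1])
    show "is_hom ((mu_map \<otimes>\<^sub>m idm (n - 1)) \<otimes>\<^sub>m idm 1)"
      by (intro is_hom_tens is_hom_idm is_hom_structure_maps)
    show "tgt (comp_list ?gs (Suc n)) = src (mu_map \<otimes>\<^sub>m idm n)"
      using hs by simp
  qed (use mu hs in blast)+
  also have "\<dots> \<approx> d_left i n \<otimes>\<^sub>m idm 1"
    unfolding d_left_def
  proof (rule eqv_sym[OF compose_tens_idm])
    show "tgt (comp_list ?fs n) = src (mu_map \<otimes>\<^sub>m idm (n - 1))"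
      using hs assms by simp
  qed (use mu hs in blast)+
  finally show ?thesis .
qed

text \<open>The last operator of the list stands innermost in the right fold and therefore acts
  first.\<close>

lemma app_comp_list_snoc:
  "app (foldr (\<circ>\<^sub>m) fs (f \<circ>\<^sub>m g)) x = app (comp_list fs n) (app f (app g x))"
  by (induction fs) simp_all

lemma d_left_last_Suc:
  assumes "1 \<le> n"
  shows "app (d_left (Suc n) (Suc n)) x = app (d_left n (Suc n)) (app (R_at n (Suc n)) x)"
  using assms by (simp add: d_left_def app_comp_list_snoc[where n = "Suc n"])

section \<open>The recursion for the last left summand, from the decomposition of R\<close>

lemma scal_minus: "scal (- c) = - scal c"
  by (simp add: scal_def single_uminus)

lemma scal_diff: "scal (c - d) = scal c - scal d"
  by (simp add: scal_def single_diff)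

lemma scal_yv_yinv: "scal yv * (scal yinv * x) = x" "scal yinv * (scal yv * x) = x"
  by (simp_all add: yv_yinv mult.commute[of yinv] scal_1 flip: mult.assoc scal_mult)

text \<open>This is \<open>R = \<one> + \<beta>\<alpha>\<close>.\<close>

lemma R_basis_eq: "R_basis [a, b] = e [a, b] + alpha_basis [a, b] * beta_basis []"
  by (cases a; cases b)
    (simp_all add: scale_def algebra_simps scal_1 scal_minus scal_diff scal_yv_yinv
      power2_eq_square scal_mult)

text \<open>In this form the value commutes with every tensor by
  \<open>scal_commute\<close>.\<close>

lemma alpha_basis_scal: "\<exists>c. alpha_basis [a, b] = scal c"
  by (cases a; cases b) (auto simp flip: scal_0)

text \<open>\<open>bump_value f u a b\<close> is \<open>(f \<otimes> \<one>) \<circ> (\<one> \<otimes> \<beta>\<alpha>)\<close> at \<open>u \<otimes> a \<otimes> b\<close>,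
  where \<open>\<beta>\<alpha>\<close> acts on the last two factors.\<close>

definition bump_value :: "lmap \<Rightarrow> basis list \<Rightarrow> basis \<Rightarrow> basis \<Rightarrow> tensor" where
  "bump_value f u a b = alpha_basis [a, b] *
     (scal yv * (app f (e (u @ [E1])) * e [E2] - app f (e (u @ [E2])) * e [E1]))"

text \<open>R acts first, on the last two factors, and is followed by \<open>d_left n n\<close> on
  the first \<open>n\<close> factors. The two terms come from the two summands of R = \<one> +
  \<beta>\<alpha>.\<close>

lemma d_left_last_append:
  assumes "1 \<le> n" "length u = n - 1"
  shows "app (d_left (Suc n) (Suc n)) (e (u @ [a, b])) =
    app (d_left n n) (e (u @ [a])) * e [b] + bump_value (d_left n n) u a b"
proof -
  let ?F = "app (d_left n (Suc n))"
  have lin: "k_linear ?F"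
    using assms by (intro k_linear_hom d_left_hom) auto
  have F: "?F (e (u @ [c, d])) = app (d_left n n) (e (u @ [c])) * e [d]" for c d
  proof -
    have "?F (e (u @ [c, d])) = app (d_left n n \<otimes>\<^sub>m idm 1) (e ((u @ [c]) @ [d]))"
      using assms by (subst eqv_app_e[OF d_left_Suc]) (simp_all add: d_left_hom)
    also have "\<dots> = app (d_left n n) (e (u @ [c])) * e [d]"
      using assms by (subst app_tens_append) (simp_all add: d_left_hom)
    finally show ?thesis .
  qed
  obtain c where c: "alpha_basis [a, b] = scal c"
    using alpha_basis_scal by blast
  have "app (R_at n (Suc n)) (e (u @ [a, b])) = e u * R_basis [a, b]"
    using assms by (simp add: R_at_def app_tens_e e_Nil)
  \<comment> \<open>The scalar \<open>c\<close> is the value of \<alpha>; the factor after it is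
    \<beta>(1), placed behind \<open>u\<close>.\<close>
  also have "\<dots> = e (u @ [a, b]) + scal c * (scal yv * (e (u @ [E1, E2]) - e (u @ [E2, E1])))"
    unfolding R_basis_eq c beta_basis.simps scale_def
    by (simp add: e_append distrib_left right_diff_distrib scal_commute[of "e u"]
        mult.assoc[symmetric])
       (simp add: mult.assoc scal_commute[of "e u"] flip: e_append)
  finally show ?thesis
    using assms by (simp add: d_left_last_Suc k_linear_simps[OF lin] F c bump_value_def)
qed


section \<open>The generators\<close>

text \<open>The relation f' = (f \<otimes> \<one>)(\<one> \<otimes> \<beta>\<alpha>), tested on
  words of the source length; \<open>src f \<ge> 1\<close> makes \<open>src f - 1\<close> a true
  predecessor.\<close>

definition bump :: "lmap \<Rightarrow> lmap \<Rightarrow> bool" where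
  "bump f f' \<longleftrightarrow> src f \<ge> 1 \<and> src f' = Suc (src f) \<and>
     (\<forall>u a b. length u = src f - 1 \<longrightarrow> app f' (e (u @ [a, b])) = bump_value f u a b)"

text \<open>The map \<beta>\<alpha> meets only the last factor of \<open>f\<close> and the new one,
  so \<open>h\<close> passes through; the scalar from \<alpha> commutes with its value.\<close>

lemma bump_tens:
  assumes "bump f f'"
  shows "bump (h \<otimes>\<^sub>m f) (h \<otimes>\<^sub>m f')"
proof -
  have "app (h \<otimes>\<^sub>m f') (e (u @ [a, b])) = bump_value (h \<otimes>\<^sub>m f) u a b"
    if "length u = src h + src f - 1" for u a b
  proof -
    define v w where "v = take (src h) u" and "w = drop (src h) u"
    have u: "u = v @ w" and v: "length v = src h" and w: "length w = src f - 1"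
      using that assms by (auto simp: v_def w_def bump_def)
    obtain c where c: "alpha_basis [a, b] = scal c"
      using alpha_basis_scal by blast
    have "app (h \<otimes>\<^sub>m f') (e (u @ [a, b])) = app h (e v) * bump_value f w a b"
      using assms w by (simp add: u app_tens_append v bump_def)
    also have "\<dots> = bump_value (h \<otimes>\<^sub>m f) u a b"
      by (simp add: bump_value_def u app_tens_append v c mult.assoc[symmetric]
          scal_commute[of "app h (e v)"])
         (simp add: mult.assoc right_diff_distrib scal_commute[of "app h (e v)"])
    finally show ?thesis .
  qed
  then show ?thesis
    using assms by (auto simp: bump_def)
qed

text \<open>The zigzag \<open>(\<alpha> \<otimes> \<one>)(\<one> \<otimes> \<beta>) = \<xi>\<close>.\<close>

lemma bump_alpha: "bump alpha_map (xi_map \<otimes>\<^sub>m alpha_map)"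
proof -
  have "xi_basis [c] * alpha_basis [a, b] = bump_value alpha_map [c] a b" for a b c
    by (cases a; cases b; cases c)
      (simp_all add: bump_value_def scale_def scal_minus scal_yv_yinv power2_eq_square scal_mult
        scal_commute[of "e w" for w] mult.assoc)
  then show ?thesis
    by (auto simp: bump_def app_tens_e length_Suc_conv)
qed

text \<open>The new \<xi> may be taken to be the rightmost one, next to \<alpha>, where the zigzag
  produces it.\<close>

lemma bump_chain:
  "bump (f \<otimes>\<^sub>m tens_list (replicate k xi_map) \<otimes>\<^sub>m alpha_map)
        (f \<otimes>\<^sub>m tens_list (replicate (Suc k) xi_map) \<otimes>\<^sub>m alpha_map)"
proof -
  have "tens_list (replicate (Suc k) xi_map) \<otimes>\<^sub>m alpha_map =
      tens_list (replicate k xi_map) \<otimes>\<^sub>m xi_map \<otimes>\<^sub>m alpha_map"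
    by (simp add: tens_list_append tens_assoc tens_idm_0_left k_linear_hom is_hom_structure_maps
        flip: replicate_append_same)
  then show ?thesis
    by (simp only: bump_tens bump_alpha)
qed

text \<open>For \<open>m = 1\<close> the map \<beta>\<alpha> is itself \<beta> \<otimes> \<alpha>,
  that is \<open>gmap 2\<close>; for larger \<open>m\<close> the zigzag inserts one more
  \<xi>.\<close>

lemma bump_gmap:
  assumes "m \<ge> 1"
  shows "bump (gmap m) (gmap (Suc m))"
proof (cases "m = 1")
  case True
  have "beta_basis [] * alpha_basis [a, b] = bump_value (idm 1) [] a b" for a b
  proof -
    obtain c where "alpha_basis [a, b] = scal c"
      using alpha_basis_scal by blast
    then show ?thesis
      by (simp add: bump_value_def scal_commute scale_def flip: e_append)
  qed
  then show ?thesis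
    using True by (auto simp: bump_def gmap_def app_tens_e e_Nil)
next
  case False
  then obtain k where "m = Suc (Suc k)"
    using assms by (cases m; cases "m - 1") auto
  then show ?thesis
    using bump_chain[of beta_map k] by (simp add: gmap_def)
qed

text \<open>The case \<open>m = 1\<close> is the identity (\<mu> \<otimes> \<one>)\<beta> =
  \<open>lambda_l_map\<close>; the other cases are again the zigzag.\<close>

lemma bump_gmap':
  assumes "m \<ge> 1"
  shows "bump (gmap' m) (gmap' (Suc m))"
proof (cases "m = 1")
  case True
  have "lambda_l_basis [] * alpha_basis [a, b] = bump_value mu_map [] a b" for a b
  proof -
    obtain c where "alpha_basis [a, b] = scal c"
      using alpha_basis_scal by blast
    then show ?thesis
      by (simp add: bump_value_def scal_commute scale_def scal_1)
  qed
  then show ?thesis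
    using True by (auto simp: bump_def gmap'_def app_tens_e e_Nil)
next
  case False
  then obtain k where "m = Suc (Suc k)"
    using assms by (cases m; cases "m - 1") auto
  then show ?thesis
    using bump_chain[of lambda_l_map k] by (simp add: gmap'_def)
qed

lemma src_generators [simp]: "m \<ge> 1 \<Longrightarrow> src (gmap m) = m" "m \<ge> 1 \<Longrightarrow> src (gmap' m) = m"
  by (auto simp: gmap_def gmap'_def)


section \<open>Words indexed by compositions\<close>

text \<open>Compositions are listed from the last block to the first one.\<close>

fun gcomp :: "nat list \<Rightarrow> lmap" where
  "gcomp [] = idm 0"
| "gcomp [m] = gmap' m"
| "gcomp (m # k # N) = gcomp (k # N) \<otimes>\<^sub>m gmap m"

definition compositions :: "nat \<Rightarrow> nat list set" where
  "compositions n = {N. N \<noteq> [] \<and> 0 \<notin> set N \<and> sum_list N = n}"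

text \<open>The counterpart of \<open>bump\<close> on compositions: the last block, which is the
  head of the list, grows by one.\<close>

fun incr :: "nat list \<Rightarrow> nat list" where
  "incr [] = []"
| "incr (m # N) = Suc m # N"

lemma src_gcomp: "N \<in> compositions n \<Longrightarrow> src (gcomp N) = n"
proof (induction N arbitrary: n rule: gcomp.induct)
  case (3 m k N)
  then have "src (gcomp (k # N)) = k + sum_list N"
    by (simp add: compositions_def)
  with 3 show ?case by (auto simp: compositions_def)
qed (auto simp: compositions_def)

lemma bump_gcomp: "N \<in> compositions n \<Longrightarrow> bump (gcomp N) (gcomp (incr N))"
  by (cases N rule: gcomp.cases) (auto simp: compositions_def bump_gmap bump_gmap' bump_tens)

section \<open>Compositions of \<open>Suc n\<close> from those of \<open>n\<close>\<close>

lemma compositions_0: "compositions 0 = {}"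
  by (auto simp: compositions_def neq_Nil_conv)

lemma compositions_1: "compositions 1 = {[1]}"
proof -
  have "N = [1]" if "N \<in> compositions 1" for N
    using that by (cases N rule: gcomp.cases) (auto simp: compositions_def add_is_1)
  then show ?thesis by (auto simp: compositions_def)
qed

text \<open>The last block either equals 1 and can be removed, or is larger and can be shortened.
  For \<open>n = 0\<close> this fails, as removing the block of \<open>[1]\<close> leaves no
  composition.\<close>

lemma compositions_Suc:
  assumes "n \<ge> 1"
  shows "compositions (Suc n) = Cons 1 ` compositions n \<union> incr ` compositions n"
proof (intro Set.set_eqI iffI)
  fix N assume N: "N \<in> compositions (Suc n)"
  then obtain m M where [simp]: "N = Suc m # M"
    by (cases N; cases "hd N") (auto simp: compositions_def)
  show "N \<in> Cons 1 ` compositions n \<union> incr ` compositions n"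
  proof (cases m)
    case 0
    then have "N = 1 # M" "M \<in> compositions n"
      using N assms by (auto simp: compositions_def)
    then show ?thesis by blast
  next
    case (Suc k)
    then have "N = incr (m # M)" "m # M \<in> compositions n"
      using N by (auto simp: compositions_def)
    then show ?thesis by blast
  qed
next
  fix N assume "N \<in> Cons 1 ` compositions n \<union> incr ` compositions n"
  then show "N \<in> compositions (Suc n)"
    by (auto simp: compositions_def neq_Nil_conv)
qed

lemma finite_compositions: "finite (compositions n)"
proof (induction n)
  case (Suc n)
  then show ?case
    by (cases "n = 0") (simp_all add: compositions_Suc compositions_1[unfolded One_nat_def])
qed (simp add: compositions_0)

lemma sum_compositions_Suc:
  assumes "n \<ge> 1"
  shows "sum F (compositions (Suc n)) = (\<Sum>N\<in>compositions n. F (1 # N) + F (incr N))"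
proof -
  have "Cons 1 ` compositions n \<inter> incr ` compositions n = {}"
    by (auto simp: compositions_def neq_Nil_conv)
  moreover have "inj_on incr (compositions n)"
  proof (rule inj_onI)
    fix N M assume "N \<in> compositions n" "M \<in> compositions n" "incr N = incr M"
    then show "N = M"
      by (cases N; cases M) (auto simp: compositions_def)
  qed
  ultimately show ?thesis
    using assms by (simp add: compositions_Suc sum.union_disjoint finite_compositions sum.reindex
        sum.distrib)
qed

text \<open>The two terms of \<open>d_left_last_append\<close> correspond to the two ways of
  extending a composition: a new block 1, or a larger last block.\<close>

lemma d_left_last_compositions:
  assumes "n \<ge> 1" "length w = n"
  shows "app (d_left n n) (e w) = (\<Sum>N\<in>compositions n. app (gcomp N) (e w))"
  using assms
proof (induction n arbitrary: w rule: nat_induct_at_least)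
  case base
  then show ?case
    unfolding compositions_1 by (simp add: d_left_def gmap'_def app_tens_e e_Nil)
next
  case (Suc n)
  then obtain v b where v: "w = v @ [b]" "length v = n"
    by (cases w rule: rev_cases) auto
  then obtain u a where "v = u @ [a]"
    using Suc.hyps by (cases v rule: rev_cases) auto
  with v have w: "w = u @ [a, b]" and u: "length u = n - 1"
    by auto
  have len: "length (u @ [c]) = n" for c
    using u Suc.hyps by simp
  have eq: "app (gcomp (1 # N)) (e w) + app (gcomp (incr N)) (e w) =
      app (gcomp N) (e (u @ [a])) * e [b] + bump_value (gcomp N) u a b"
    if N: "N \<in> compositions n" for N
  proof -
    have "gcomp (1 # N) = gcomp N \<otimes>\<^sub>m idm 1"
      using N by (cases N) (auto simp: compositions_def gmap_def)
    then have "app (gcomp (1 # N)) (e ((u @ [a]) @ [b])) = app (gcomp N) (e (u @ [a])) * e [b]"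
      using len by (simp only: app_tens_append src_gcomp[OF N] app_idm)
    moreover have "app (gcomp (incr N)) (e w) = bump_value (gcomp N) u a b"
      using bump_gcomp[OF N] u by (simp add: bump_def src_gcomp[OF N] w)
    ultimately show ?thesis by (simp add: w)
  qed
  have "app (d_left (Suc n) (Suc n)) (e w) =
      app (d_left n n) (e (u @ [a])) * e [b] + bump_value (d_left n n) u a b"
    unfolding w using Suc.hyps u by (rule d_left_last_append)
  \<comment> \<open>The expression \<open>bump_value f u a b\<close> is linear in \<open>f\<close>,
    so the induction hypothesis can be inserted in both terms.\<close>
  also have "\<dots> = (\<Sum>N\<in>compositions n.
      app (gcomp N) (e (u @ [a])) * e [b] + bump_value (gcomp N) u a b)"
    using Suc.IH[OF len]
    by (simp add: bump_value_def sum.distrib sum_subtractf sum_distrib_left sum_distrib_right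
        right_diff_distrib)
  also have "\<dots> = (\<Sum>N\<in>compositions (Suc n). app (gcomp N) (e w))"
    by (simp add: sum_compositions_Suc[OF Suc.hyps] eq del: One_nat_def)
  finally show ?case .
qed

text \<open>The first block, which is the last entry of the list, belongs to \<open>g'\<close> and is not counted
  among the trailing ones.\<close>

definition even_compositions :: "nat \<Rightarrow> nat list set" where
  "even_compositions n = {N \<in> compositions n. even (length (takeWhile ((=) 1) (butlast N)))}"

section \<open>Telescoping of the alternating sum\<close>

lemma sum_compositions_even:
  "sum F (compositions (Suc n)) =
    sum F (even_compositions (Suc n)) + (\<Sum>N\<in>even_compositions n. F (1 # N))"
proof -
  let ?odd = "{N \<in> compositions (Suc n). odd (length (takeWhile ((=) 1) (butlast N)))}"
  have "?odd = Cons 1 ` even_compositions n"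
  proof (intro Set.set_eqI iffI)
    \<comment> \<open>An odd count of ones in \<open>butlast N\<close> is nonzero, so
      \<open>N\<close> starts with 1 and has a further block; removing the 1 makes the count
      even.\<close>
    fix N assume N: "N \<in> ?odd"
    then obtain M where "N = 1 # M" "M \<noteq> []"
      by (cases N) (auto split: if_splits)
    with N show "N \<in> Cons 1 ` even_compositions n"
      by (auto simp: even_compositions_def compositions_def)
  next
    fix N assume "N \<in> Cons 1 ` even_compositions n"
    then show "N \<in> ?odd"
      by (auto simp: even_compositions_def compositions_def)
  qed
  then have "sum F ?odd = (\<Sum>N\<in>even_compositions n. F (1 # N))"
    by (simp add: sum.reindex)
  moreover have "compositions (Suc n) = even_compositions (Suc n) \<union> ?odd"
    "even_compositions (Suc n) \<inter> ?odd = {}"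
    by (auto simp: even_compositions_def)
  ultimately show ?thesis
    by (metis (no_types, lifting) finite_Un finite_compositions sum.union_disjoint)
qed

text \<open>The last summand runs over all compositions of \<open>Suc n\<close>. Those with an odd
  number of trailing ones are words for \<open>n\<close> extended by \<open>g_1\<close>, and they
  cancel \<open>left_diff n\<close> tensored with the identity because the signs are
  opposite.\<close>

lemma left_diff_compositions:
  assumes "length w = n"
  shows "app (left_diff n) (e w) = (- 1) ^ n * (\<Sum>N\<in>even_compositions n. app (gcomp N) (e w))"
  using assms
proof (induction n arbitrary: w)
  case 0
  then show ?case by (simp add: left_diff_def even_compositions_def compositions_0)
next
  case (Suc n)
  then obtain u b where w: "w = u @ [b]" and u: "length u = n"
    by (cases w rule: rev_cases) auto
  have d: "app (d_left i (Suc n)) (e w) = app (d_left i n) (e u) * e [b]" if "i \<in> {1..n}" for i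
  proof -
    have "app (d_left i (Suc n)) (e w) = app (d_left i n \<otimes>\<^sub>m idm 1) (e (u @ [b]))"
      using that u by (subst eqv_app_e[OF d_left_Suc]) (simp_all add: d_left_hom w)
    also have "\<dots> = app (d_left i n) (e u) * e [b]"
      using that u by (subst app_tens_append) (simp_all add: d_left_hom)
    finally show ?thesis .
  qed
  have g: "app (gcomp (1 # N)) (e w) = app (gcomp N) (e u) * e [b]"
    if "N \<in> even_compositions n" for N
  proof -
    have N: "N \<in> compositions n"
      using that by (simp add: even_compositions_def)
    then have "gcomp (1 # N) = gcomp N \<otimes>\<^sub>m idm 1"
      by (cases N) (auto simp: compositions_def gmap_def)
    then show ?thesis
      using u by (simp only: w app_tens_append src_gcomp[OF N] app_idm)
  qed
  have "app (left_diff (Suc n)) (e w) =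
      app (left_diff n) (e u) * e [b] + (- 1) ^ Suc n * app (d_left (Suc n) (Suc n)) (e w)"
    by (simp add: left_diff_def d sum_distrib_right mult.assoc)
  also have "app (d_left (Suc n) (Suc n)) (e w) =
      (\<Sum>N\<in>even_compositions (Suc n). app (gcomp N) (e w)) +
      (\<Sum>N\<in>even_compositions n. app (gcomp N) (e u)) * e [b]"
    using Suc.prems by (simp add: d_left_last_compositions sum_compositions_even g
        sum_distrib_right del: One_nat_def)
  finally show ?case
    by (simp add: Suc.IH[OF u] algebra_simps)
qed


section \<open>The index set\<close>

definition expand_runs :: "(nat \<times> nat) list \<Rightarrow> nat list" where
  "expand_runs ps = concat (map (\<lambda>(i, k). replicate k i) ps)"

lemma expand_runs_simps [simp]:
  "expand_runs [] = []" "expand_runs ((i, k) # ps) = replicate k i @ expand_runs ps"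
  by (simp_all add: expand_runs_def)

fun cons_run :: "nat \<Rightarrow> (nat \<times> nat) list \<Rightarrow> (nat \<times> nat) list" where
  "cons_run a [] = [(a, 1)]"
| "cons_run a ((i, k) # ps) = (if a = i then (i, Suc k) # ps else (a, 1) # (i, k) # ps)"

definition run_lengths :: "nat list \<Rightarrow> (nat \<times> nat) list" where
  "run_lengths L = foldr cons_run L []"

lemma run_lengths_simps [simp]:
  "run_lengths [] = []" "run_lengths (a # L) = cons_run a (run_lengths L)"
  by (simp_all add: run_lengths_def)

lemma expand_run_lengths: "expand_runs (run_lengths L) = L"
proof (induction L)
  case (Cons a L)
  have "expand_runs (cons_run a ps) = a # expand_runs ps" for ps
    by (cases "(a, ps)" rule: cons_run.cases) auto
  with Cons show ?case by simp
qed simp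

text \<open>The clause on the head carries the induction for \<open>distinct_adj\<close>; it also
  yields the condition that i_h differs from 1 later on.\<close>

lemma run_lengths_valid:
  "distinct_adj (map fst (run_lengths L)) \<and>
   (\<forall>(i, k) \<in> set (run_lengths L). i \<in> set L \<and> k \<ge> 1) \<and>
   (run_lengths L = [] \<longleftrightarrow> L = []) \<and> (L \<noteq> [] \<longrightarrow> fst (hd (run_lengths L)) = hd L)"
proof (induction L)
  case (Cons a L)
  then show ?case
    by (cases "(a, run_lengths L)" rule: cons_run.cases) (auto simp: distinct_adj_Cons)
qed simp

text \<open>Distinct neighbours keep runs from merging and positive multiplicities keep them from
  vanishing, so the code is canonical.\<close>

lemma run_lengths_expand:
  assumes "distinct_adj (map fst ps)" "\<forall>(i, k) \<in> set ps. k \<ge> 1"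
  shows "run_lengths (expand_runs ps) = ps"
  using assms
proof (induction ps)
  case (Cons p ps)
  obtain i k where p: "p = (i, k)" by (cases p)
  \<comment> \<open>The innermost \<open>i\<close> opens a new run, since \<open>ps\<close> does not
    start with a run of \<open>i\<close>; each further \<open>i\<close> joins it.\<close>
  have *: "foldr cons_run (replicate (Suc k) i) ps = (i, Suc k) # ps" for k
    using Cons.prems by (induction k) (cases ps; auto simp: p distinct_adj_Cons)+
  have "run_lengths (expand_runs ps) = ps"
    using Cons by (auto simp: distinct_adj_Cons)
  moreover obtain k' where "k = Suc k'"
    using Cons.prems by (cases k) (auto simp: p)
  ultimately show ?case
    using *[of k'] by (simp add: p run_lengths_def)
qed simp

lemma sum_list_expand_runs: "sum_list (expand_runs ps) = (\<Sum>(i, k) \<leftarrow> ps. k * i)"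
  by (induction ps) (auto simp: sum_list_replicate)

lemma set_expand_runs: "set (expand_runs ps) \<subseteq> fst ` set ps"
  by (induction ps) force+

lemma rev_expand_runs: "rev (expand_runs ps) = expand_runs (rev ps)"
proof -
  have "rev \<circ> (\<lambda>(i :: nat, k). replicate k i) = (\<lambda>(i, k). replicate k i)"
    by (auto simp: fun_eq_iff)
  then show ?thesis
    by (simp add: expand_runs_def rev_concat rev_map)
qed

text \<open>The word is read backwards, as compositions start with the last block: the factors
  \<open>g_1\<close> come first and the block of g' comes last.\<close>

fun index_composition :: "index \<Rightarrow> nat list" where
  "index_composition (i0, ps, q) = replicate (2 * q) 1 @ expand_runs (rev ps) @ [i0]"

text \<open>Because i_h differs from 1, the initial ones of the reversed word are exactly the
  \<open>2 * q\<close> separate factors, and \<open>q\<close> can be recovered.\<close>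

lemma index_composition_runs:
  assumes "(i0, ps, q) \<in> index_set n"
  shows "takeWhile ((=) 1) (replicate (2 * q) 1 @ expand_runs (rev ps)) = replicate (2 * q) 1"
    and "dropWhile ((=) 1) (replicate (2 * q) 1 @ expand_runs (rev ps)) = expand_runs (rev ps)"
proof -
  have "expand_runs (rev ps) = [] \<or> hd (expand_runs (rev ps)) \<noteq> 1"
  proof (cases ps rule: rev_cases)
    case (snoc ps' p)
    then show ?thesis
      using assms by (cases p; cases "snd p") (auto simp: index_set_def)
  qed simp
  then have "takeWhile ((=) 1) (expand_runs (rev ps)) = []"
    "dropWhile ((=) 1) (expand_runs (rev ps)) = expand_runs (rev ps)"
    by (cases "expand_runs (rev ps)"; simp)+
  then show "takeWhile ((=) 1) (replicate (2 * q) 1 @ expand_runs (rev ps)) = replicate (2 * q) 1"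
    and "dropWhile ((=) 1) (replicate (2 * q) 1 @ expand_runs (rev ps)) = expand_runs (rev ps)"
    by (simp_all add: takeWhile_append dropWhile_append)
qed

lemma sum_list_takeWhile_1: "sum_list (takeWhile ((=) (1 :: nat)) xs) = length (takeWhile ((=) 1) xs)"
  by (induction xs) auto

lemma bij_betw_index_composition:
  "bij_betw index_composition (index_set n) (even_compositions n)"
proof -
  \<comment> \<open>The inverse: the block of g' is the last entry, half the number of leading ones
    is \<open>q\<close>, and the run lengths of the rest are reversed back into word order.\<close>
  define index_of :: "nat list \<Rightarrow> index" where
    "index_of N = (last N, rev (run_lengths (dropWhile ((=) 1) (butlast N))),
       length (takeWhile ((=) 1) (butlast N)) div 2)" for N
  show ?thesis
  proof (rule bij_betw_byWitness[where f' = index_of])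
    show "\<forall>s\<in>index_set n. index_of (index_composition s) = s"
    proof
      fix s assume s: "s \<in> index_set n"
      obtain i0 ps q where [simp]: "s = (i0, ps, q)" by (cases s)
      have "run_lengths (expand_runs (rev ps)) = rev ps"
        using s by (intro run_lengths_expand) (auto simp: index_set_def simp flip: rev_map)
      then show "index_of (index_composition s) = s"
        using index_composition_runs[of i0 ps q n] s
        by (simp add: index_of_def flip: append_assoc)
    qed
    show "\<forall>N\<in>even_compositions n. index_composition (index_of N) = N"
    proof
      fix N assume N: "N \<in> even_compositions n"
      let ?t = "takeWhile ((=) 1) (butlast N)"
      have "replicate (length ?t) 1 = ?t"
        by (rule replicate_length_same) (auto dest: set_takeWhileD)
      \<comment> \<open>Halving and doubling the number of ones loses nothing because that number is
        even.\<close>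
      then have "index_composition (index_of N) =
          (?t @ dropWhile ((=) 1) (butlast N)) @ [last N]"
        using N by (simp add: index_of_def expand_run_lengths even_compositions_def
            del: takeWhile_dropWhile_id)
      then show "index_composition (index_of N) = N"
        using N by (simp add: even_compositions_def compositions_def)
    qed
    show "index_composition ` index_set n \<subseteq> even_compositions n"
    proof
      fix N assume "N \<in> index_composition ` index_set n"
      then obtain i0 ps q where s: "(i0, ps, q) \<in> index_set n"
        and N: "N = index_composition (i0, ps, q)"
        by auto
      have "0 \<notin> fst ` set ps"
        using s by (force simp: index_set_def)
      then have "0 \<notin> set N"
        using s set_expand_runs[of "rev ps"] by (auto simp: N index_set_def)
      moreover have "sum_list N = n"
        using s by (simp add: N index_set_def sum_list_replicate sum_list_expand_runs
            flip: rev_map)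
      ultimately show "N \<in> even_compositions n"
        using index_composition_runs(1)[OF s]
        by (simp add: N even_compositions_def compositions_def flip: append_assoc)
    qed
    show "index_of ` even_compositions n \<subseteq> index_set n"
    proof
      fix s assume "s \<in> index_of ` even_compositions n"
      then obtain N where N: "N \<in> even_compositions n" and s: "s = index_of N"
        by auto
      let ?t = "takeWhile ((=) 1) (butlast N)" and ?d = "dropWhile ((=) 1) (butlast N)"
      let ?ps = "run_lengths ?d"
      have "set ?d \<subseteq> set N"
        by (meson in_set_butlastD set_dropWhileD subsetI)
      moreover have "last N \<in> set N" "0 \<notin> set N"
        using N by (auto simp: even_compositions_def compositions_def)
      ultimately have "0 \<notin> set ?d" "last N \<noteq> 0"
        by (blast, metis)
      then have pos: "\<forall>(i, k) \<in> set ?ps. i \<ge> 1 \<and> k \<ge> 1"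
        using run_lengths_valid[of ?d] by (fastforce simp: Suc_le_eq intro: gr0I)
      \<comment> \<open>After \<open>dropWhile\<close> the first entry is not 1; reversing the run
        lengths turns this into the condition on i_h.\<close>
      have hd: "?ps \<noteq> [] \<longrightarrow> fst (hd ?ps) \<noteq> 1"
        using run_lengths_valid[of ?d] hd_dropWhile[of "(=) 1" "butlast N"] by metis
      have "sum_list (?t @ ?d @ [last N]) = n"
        using N by (simp only: append_assoc[symmetric] takeWhile_dropWhile_id)
          (simp add: even_compositions_def compositions_def)
      moreover have "sum_list ?t = length ?t"
        by (rule sum_list_takeWhile_1)
      moreover have "sum_list ?d = (\<Sum>(i, k) \<leftarrow> ?ps. k * i)"
        by (metis expand_run_lengths sum_list_expand_runs)
      moreover have "even (length ?t)"
        using N by (simp add: even_compositions_def)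
      ultimately have "last N + (\<Sum>(i, k) \<leftarrow> ?ps. k * i) + 2 * (length ?t div 2) = n"
        by simp
      then show "s \<in> index_set n"
        using pos hd run_lengths_valid[of ?d] \<open>last N \<noteq> 0\<close>
        by (simp add: s index_of_def index_set_def rev_map[symmetric] last_rev Suc_le_eq
            del: takeWhile_dropWhile_id)
    qed
  qed
qed

section \<open>Identification of the words of compositions with those of the index set\<close>

lemma gcomp_snoc: "gcomp (N @ [i]) \<approx> tens_list (gmap' i # map gmap (rev N))"
proof (induction N)
  case Nil
  show ?case by (simp add: eqv_sym tens_idm_0_right)
next
  case (Cons m N)
  have "gcomp ((m # N) @ [i]) = gcomp (N @ [i]) \<otimes>\<^sub>m gmap m"
    by (cases N) simp_all
  also have "\<dots> \<approx> tens_list (gmap' i # map gmap (rev N)) \<otimes>\<^sub>m gmap m"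
    by (intro tens_cong Cons.IH eqv_refl)
  also have "\<dots> \<approx> tens_list ((gmap' i # map gmap (rev N)) @ [gmap m])"
    by (rule eqv_sym[OF tens_list_snoc])
  finally show ?case by simp
qed

lemma gword_eq_tens_list:
  "gword (i0, ps, q) = tens_list (gmap' i0 # map gmap (expand_runs ps @ replicate (2 * q) 1))"
  by (simp add: expand_runs_def map_concat case_prod_unfold comp_def)

lemma hword_eq_tens_list:
  "hword (i0, ps, q) =
    tens_list (map hmap (rev (expand_runs ps @ replicate (2 * q) 1)) @ [hmap' i0])"
  by (simp add: rev_expand_runs) (simp add: expand_runs_def map_concat case_prod_unfold comp_def)

lemma gcomp_index_composition: "gcomp (index_composition s) \<approx> gword s"
proof -
  obtain i0 ps q where s: "s = (i0, ps, q)" by (cases s)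
  show ?thesis
    using gcomp_snoc[of "replicate (2 * q) 1 @ expand_runs (rev ps)" i0]
    by (simp add: s gword_eq_tens_list rev_expand_runs del: gword.simps tens_list_Cons)
qed

lemma src_gword: "s \<in> index_set n \<Longrightarrow> src (gword s) = n"
proof -
  assume "s \<in> index_set n"
  then have "index_composition s \<in> compositions n"
    using bij_betw_apply[OF bij_betw_index_composition] by (simp add: even_compositions_def)
  then show ?thesis
    using gcomp_index_composition[of s] src_gcomp by (auto simp: lmap_eqv_def)
qed

lemma left_diff_e:
  assumes "length w = n"
  shows "app (left_diff n) (e w) = (- 1) ^ n * (\<Sum>s\<in>index_set n. app (gword s) (e w))"
proof -
  have "app (gcomp (index_composition s)) (e w) = app (gword s) (e w)" if "s \<in> index_set n" for s
    using gcomp_index_composition[of s] src_gword[OF that] assms by (auto simp: lmap_eqv_def)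
  then have "(\<Sum>N\<in>even_compositions n. app (gcomp N) (e w)) =
      (\<Sum>s\<in>index_set n. app (gword s) (e w))"
    by (simp flip: sum.reindex_bij_betw[OF bij_betw_index_composition])
  then show ?thesis
    using assms by (simp add: left_diff_compositions)
qed


section \<open>The mirror symmetry\<close>

fun swap_basis :: "basis \<Rightarrow> basis" where
  "swap_basis E1 = E2"
| "swap_basis E2 = E1"

lemma swap_basis_swap_basis [simp]: "swap_basis (swap_basis b) = b"
  by (cases b) simp_all

definition mirror_word :: "basis list \<Rightarrow> basis list" where
  "mirror_word w = rev (map swap_basis w)"

lemma mirror_word_simps [simp]:
  "length (mirror_word w) = length w" "mirror_word (mirror_word w) = w"
  "mirror_word (u @ v) = mirror_word v @ mirror_word u" "mirror_word [] = []"
  "mirror_word (b # w) = mirror_word w @ [swap_basis b]"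
  by (simp_all add: mirror_word_def rev_map comp_def)

definition mirror_tensor :: "tensor \<Rightarrow> tensor" where
  "mirror_tensor = lin (\<lambda>w. e (mirror_word w))"

lemma mirror_tensor_e [simp]: "mirror_tensor (e w) = e (mirror_word w)"
  by (simp add: mirror_tensor_def lin_e)

lemma k_linear_mirror_tensor: "k_linear mirror_tensor"
  by (simp add: mirror_tensor_def k_linear_lin)

lemmas mirror_tensor_simps [simp] = k_linear_simps[OF k_linear_mirror_tensor]

lemma mirror_tensor_1 [simp]: "mirror_tensor 1 = 1"
  by (simp flip: e_Nil)

lemma mirror_tensor_of_scal [simp]: "mirror_tensor (scal c) = scal c"
  using mirror_tensor_simps(2)[of c 1] by (simp del: mirror_tensor_simps)

lemma mirror_tensor_involution [simp]: "mirror_tensor (mirror_tensor x) = x"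
  by (rule k_linear_ext) (auto intro: k_linearI)

text \<open>Both sides are linear in each argument, and on words this is the reversal of a
  concatenation.\<close>

lemma mirror_tensor_mult: "mirror_tensor (x * y) = mirror_tensor y * mirror_tensor x"
proof (rule k_linear_ext[of "\<lambda>x. mirror_tensor (x * y)"])
  show "mirror_tensor (e u * y) = mirror_tensor y * mirror_tensor (e u)" for u
  proof (rule k_linear_ext[of "\<lambda>y. mirror_tensor (e u * y)"])
    have "e u * (scal c * y) = scal c * (e u * y)" for c y
      by (simp add: scal_commute[of "e u"] flip: mult.assoc)
    then show "k_linear (\<lambda>y. mirror_tensor (e u * y))"
      by (intro k_linearI) (simp_all add: distrib_left)
  qed (auto intro!: k_linearI simp: algebra_simps simp flip: e_append)
  have "x * (scal c * y) = scal c * (x * y)" for c x y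
    by (simp add: scal_commute[of x] flip: mult.assoc)
  then show "k_linear (\<lambda>x. mirror_tensor y * mirror_tensor x)"
    by (intro k_linearI) (simp_all add: distrib_left)
qed (auto intro!: k_linearI simp: algebra_simps)

lemma mirror_tensor_tpower: "x \<in> tpower n \<Longrightarrow> mirror_tensor x \<in> tpower n"
  using is_hom_lin[of n "\<lambda>w. e (mirror_word w)" n]
  by (simp add: is_hom_def mirror_tensor_def tpower_e)

text \<open>Conjugation by the involution \<open>mirror_tensor\<close>. It respects composition and
  reverses the order of tensor factors.\<close>

definition mirror :: "lmap \<Rightarrow> lmap" where
  "mirror f = LMap (src f) (tgt f) (\<lambda>x. mirror_tensor (app f (mirror_tensor x)))"

lemma mirror_simps [simp]:
  "src (mirror f) = src f" "tgt (mirror f) = tgt f"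
  "app (mirror f) x = mirror_tensor (app f (mirror_tensor x))"
  by (simp_all add: mirror_def)

lemma mirror_idm: "mirror (idm n) = idm n"
  by (simp add: mirror_def idm_def)

lemma mirror_compose: "mirror (f \<circ>\<^sub>m g) = mirror f \<circ>\<^sub>m mirror g"
  by (simp add: mirror_def compose_def fun_eq_iff)

lemma is_hom_mirror: "is_hom f \<Longrightarrow> is_hom (mirror f)"
  by (simp add: is_hom_def mirror_tensor_tpower scale_def)

lemma mirror_tens: "mirror (f \<otimes>\<^sub>m g) \<approx> mirror g \<otimes>\<^sub>m mirror f"
proof -
  have "app (mirror (f \<otimes>\<^sub>m g)) (e w) = app (mirror g \<otimes>\<^sub>m mirror f) (e w)"
    if "length w = src f + src g" for w
  proof -
    define u v where "u = take (src g) w" and "v = drop (src g) w"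
    then have w: "w = u @ v" "length u = src g" "length v = src f"
      using that by auto
    then show ?thesis
      by (simp add: app_tens_append mirror_tensor_mult)
  qed
  then show ?thesis by (simp add: lmap_eqv_def add.commute)
qed

lemma mirror_tens_cong: "mirror f \<approx> f' \<Longrightarrow> mirror g \<approx> g' \<Longrightarrow> mirror (f \<otimes>\<^sub>m g) \<approx> g' \<otimes>\<^sub>m f'"
  by (rule eqv_trans[OF mirror_tens]) (rule tens_cong)

lemma mirror_tens_list:
  "list_all2 (\<lambda>f g. mirror f \<approx> g) fs gs \<Longrightarrow> mirror (tens_list fs) \<approx> tens_list (rev gs)"
proof (induction rule: list_all2_induct)
  case (Cons f fs g gs)
  then have "mirror (tens_list (f # fs)) \<approx> tens_list (rev gs) \<otimes>\<^sub>m g"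
    by (simp add: mirror_tens_cong)
  also have "\<dots> \<approx> tens_list (rev (g # gs))"
    by (simp add: eqv_sym[OF tens_list_snoc])
  finally show ?case .
qed (simp add: mirror_idm)

text \<open>The words \<open>[E1, E2]\<close> and \<open>[E2, E1]\<close> are their own mirror
  images, while \<open>[E1, E1]\<close> and \<open>[E2, E2]\<close> are exchanged; this leaves R,
  \<alpha> and \<beta> unchanged. On single letters mirroring swaps \<open>E1\<close> and
  \<open>E2\<close>.\<close>

lemma mirror_structure_maps:
  "mirror R_map \<approx> R_map" "mirror mu_map \<approx> mu_map"
  "mirror alpha_map \<approx> alpha_map" "mirror beta_map \<approx> beta_map"
  "mirror xi_map \<approx> zeta_map" "mirror lambda_l_map \<approx> lambda_r_map"
proof -
  have 1: "w \<in> {[E1], [E2]}" if w: "length w = Suc 0" for w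
  proof -
    obtain a where "w = [a]"
      using w by (auto simp: length_Suc_conv)
    then show ?thesis by (cases a) auto
  qed
  have 2: "w \<in> {[E1, E1], [E1, E2], [E2, E1], [E2, E2]}" if w: "length w = 2" for w
  proof -
    obtain a b where "w = [a, b]"
      using w by (auto simp: numeral_2_eq_2 length_Suc_conv)
    then show ?thesis by (cases a; cases b) auto
  qed
  show "mirror R_map \<approx> R_map" "mirror alpha_map \<approx> alpha_map"
    by (auto simp: lmap_eqv_def scale_def dest!: 2)
  show "mirror mu_map \<approx> mu_map" "mirror xi_map \<approx> zeta_map"
    by (auto simp: lmap_eqv_def scale_def dest!: 1)
  show "mirror beta_map \<approx> beta_map" "mirror lambda_l_map \<approx> lambda_r_map"
    by (auto simp: lmap_eqv_def scale_def)
qed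

lemma mirror_chain:
  assumes "mirror f \<approx> f'" "mirror g \<approx> g'"
  shows "mirror (f \<otimes>\<^sub>m tens_list (replicate k xi_map) \<otimes>\<^sub>m g) \<approx>
    g' \<otimes>\<^sub>m tens_list (replicate k zeta_map) \<otimes>\<^sub>m f'"
proof -
  have "mirror (tens_list (replicate k xi_map)) \<approx> tens_list (rev (replicate k zeta_map))"
    by (intro mirror_tens_list) (simp add: list_all2_conv_all_nth mirror_structure_maps)
  then have "mirror (tens_list (replicate k xi_map)) \<approx> tens_list (replicate k zeta_map)"
    by simp
  from mirror_tens_cong[OF assms(1) mirror_tens_cong[OF this assms(2)]] show ?thesis
    by (simp add: tens_assoc)
qed

lemma mirror_gmap: "mirror (gmap m) \<approx> hmap m" "mirror (gmap' m) \<approx> hmap' m"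
  by (simp_all add: gmap_def hmap_def gmap'_def hmap'_def mirror_idm mirror_chain
      mirror_structure_maps)

lemma mirror_gword: "mirror (gword s) \<approx> hword s"
proof -
  obtain i0 ps q where s: "s = (i0, ps, q)" by (cases s)
  let ?L = "expand_runs ps @ replicate (2 * q) 1"
  have "mirror (tens_list (gmap' i0 # map gmap ?L)) \<approx> tens_list (rev (hmap' i0 # map hmap ?L))"
    by (intro mirror_tens_list) (simp add: mirror_gmap list.rel_map list.rel_refl del: map_append)
  then show ?thesis
    by (simp add: s gword_eq_tens_list hword_eq_tens_list rev_map
        del: gword.simps hword.simps tens_list_Cons)
qed

section \<open>Mirror images of the differentials\<close>

lemma mirror_R_at:
  assumes "1 \<le> p" "p < n"
  shows "mirror (R_at p n) \<approx> R_at (n - p) n"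
proof -
  have "mirror (R_at p n) \<approx> (idm (n - p - 1) \<otimes>\<^sub>m R_map) \<otimes>\<^sub>m idm (p - 1)"
    unfolding R_at_def by (intro mirror_tens_cong) (simp_all add: mirror_idm mirror_structure_maps)
  then show ?thesis
    using assms by (simp add: R_at_def tens_assoc)
qed

lemma mirror_comp_list: "mirror (comp_list fs n) = comp_list (map mirror fs) n"
  by (induction fs) (simp_all add: mirror_idm mirror_compose)

text \<open>The positions 1, ..., i - 1 of R become n - 1, ..., n - i + 1 in the same order of
  composition, and \<mu> moves from the first factor to the last.\<close>

lemma mirror_d_left:
  assumes "1 \<le> i" "i \<le> n"
  shows "mirror (d_left i n) \<approx> d_right (Suc n - i) n"
proof -
  let ?fs = "map (\<lambda>p. mirror (R_at p n)) [1..<i]"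
  let ?gs = "map (\<lambda>p. R_at p n) (rev [Suc n - i..<n])"
  have fs: "is_hom f \<and> src f = n \<and> tgt f = n" if "f \<in> set ?fs" for f
    using that assms by (auto simp: R_at_hom is_hom_mirror)
  have gs: "is_hom f \<and> src f = n \<and> tgt f = n" if "f \<in> set ?gs" for f
    using that assms by (auto simp: R_at_hom)
  have "list_all2 (\<approx>) ?fs ?gs"
    using assms mirror_R_at
    by (auto simp: list_all2_conv_all_nth rev_nth simp del: upt_Suc)
  then have comp: "comp_list ?fs n \<approx> comp_list ?gs n"
    using fs gs by (intro comp_list_cong) auto
  have mu: "mirror (mu_map \<otimes>\<^sub>m idm (n - 1)) \<approx> idm (n - 1) \<otimes>\<^sub>m mu_map"
    by (intro mirror_tens_cong) (simp_all add: mirror_idm mirror_structure_maps)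
  have hs: "is_hom (comp_list ?fs n) \<and> src (comp_list ?fs n) = n \<and> tgt (comp_list ?fs n) = n"
    by (rule comp_list_hom, rule fs)
  have "mirror (d_left i n) = mirror (mu_map \<otimes>\<^sub>m idm (n - 1)) \<circ>\<^sub>m comp_list ?fs n"
    by (simp add: d_left_def mirror_compose mirror_comp_list comp_def)
  also have "\<dots> \<approx> (idm (n - 1) \<otimes>\<^sub>m mu_map) \<circ>\<^sub>m comp_list ?gs n"
  proof (rule compose_cong[OF mu comp])
    show "is_hom (mirror (mu_map \<otimes>\<^sub>m idm (n - 1)))" "is_hom (idm (n - 1) \<otimes>\<^sub>m mu_map)"
      by (intro is_hom_mirror is_hom_tens is_hom_idm is_hom_structure_maps)+
    show "tgt (comp_list ?fs n) = src (mirror (mu_map \<otimes>\<^sub>m idm (n - 1)))"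
      using hs assms by simp
  qed (use hs in blast)
  finally show ?thesis by (simp only: d_right_def)
qed

text \<open>Replacing \<open>i\<close> by \<open>n + 1 - i\<close> costs the sign
  \<open>(- 1) ^ (n + 1)\<close>; with the factor \<open>(- 1) ^ n\<close> of the left formula it
  leaves one minus sign.\<close>

lemma right_diff_e:
  assumes "length w = n"
  shows "(\<Sum>i=1..n. (- 1) ^ i * app (d_right i n) (e w)) = - (\<Sum>s\<in>index_set n. app (hword s) (e w))"
proof -
  let ?w = "mirror_word w"
  \<comment> \<open>The index has the shape that \<open>sum.atLeastAtMost_rev\<close>
    produces.\<close>
  have d: "app (d_right (n + 1 - i) n) (e w) = mirror_tensor (app (d_left i n) (e ?w))"
    if "i \<in> {1..n}" for i
    using eqv_app_e[OF mirror_d_left[of i n], of w] that assms by (simp add: d_left_hom)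
  have h: "mirror_tensor (app (gword s) (e ?w)) = app (hword s) (e w)" if "s \<in> index_set n" for s
    using eqv_app_e[OF mirror_gword[of s], of w] src_gword[OF that] assms by simp
  have sign: "(- 1 :: tensor) ^ (n + 1 - i) = (- 1) ^ (n + 1) * (- 1) ^ i" if "i \<in> {1..n}" for i
    using that by (simp add: minus_one_power_iff)
  have "(\<Sum>i=1..n. (- 1) ^ i * app (d_right i n) (e w)) =
      (\<Sum>i=1..n. (- 1) ^ (n + 1 - i) * app (d_right (n + 1 - i) n) (e w))"
    by (rule sum.atLeastAtMost_rev)
  also have "\<dots> = (\<Sum>i=1..n. (- 1) ^ (n + 1) * mirror_tensor ((- 1) ^ i * app (d_left i n) (e ?w)))"
    by (intro sum.cong refl) (simp only: d sign mult.assoc mirror_tensor_simps)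
  also have "\<dots> = (- 1) ^ (n + 1) * mirror_tensor (app (left_diff n) (e ?w))"
    by (simp add: left_diff_def sum_distrib_left sum_negf)
  also have "\<dots> = - (\<Sum>s\<in>index_set n. app (hword s) (e w))"
    using assms by (simp add: left_diff_e h minus_one_power_iff)
  finally show ?thesis .
qed

section \<open>From words to all tensors of degree \<open>n\<close>\<close>

lemma k_linear_left_diff: "k_linear (app (left_diff n))"
  unfolding left_diff_def lmap.sel
  by (intro k_linear_fun_sum k_linear_fun_sign k_linear_hom d_left_hom) auto

lemma k_linear_yb_diff: "k_linear (app (yb_diff n))"
  unfolding yb_diff_def lmap.sel
  by (intro k_linear_fun_sum k_linear_fun_sign k_linear_fun_diff k_linear_hom d_left_hom
      d_right_hom) auto

lemma yb_diff_e:
  assumes "length w = n"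
  shows "app (yb_diff n) (e w) = (- 1) ^ n * (\<Sum>s\<in>index_set n. app (gword s) (e w)) +
    (\<Sum>s\<in>index_set n. app (hword s) (e w))"
  using left_diff_e[OF assms] right_diff_e[OF assms]
  by (simp add: yb_diff_def left_diff_def right_diff_distrib sum_subtractf)

theorem theorem4p1:
  fixes n :: nat
  assumes "n \<ge> 1"
  shows "(\<forall>x \<in> tpower n.
            app (left_diff n) x = (- 1) ^ n * (\<Sum>s \<in> index_set n. app (gword s) x)) \<and>
         (odd n \<longrightarrow> (\<forall>x \<in> tpower n.
            app (yb_diff n) x =
              - (\<Sum>s \<in> index_set n. app (gword s) x) + (\<Sum>s \<in> index_set n. app (hword s) x))) \<and>
         (even n \<longrightarrow> (\<forall>x \<in> tpower n.
            app (yb_diff n) x =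
              (\<Sum>s \<in> index_set n. app (gword s) x) + (\<Sum>s \<in> index_set n. app (hword s) x)))"
proof -
  have G: "k_linear (\<lambda>x. (- 1) ^ n * (\<Sum>s\<in>index_set n. app (gword s) x))"
    by (intro k_linear_fun_sign k_linear_fun_sum k_linear_hom is_hom_words)
  have H: "k_linear (\<lambda>x. \<Sum>s\<in>index_set n. app (hword s) x)"
    by (intro k_linear_fun_sum k_linear_hom is_hom_words)
  \<comment> \<open>Both sides are linear, so the formulas on words suffice; the parity of
    \<open>n\<close> then decides the sign \<open>(- 1) ^ n\<close>.\<close>
  have "app (left_diff n) x = (- 1) ^ n * (\<Sum>s\<in>index_set n. app (gword s) x)"
    if "x \<in> tpower n" for x
    using k_linear_left_diff G left_diff_e that by (rule k_linear_eqI)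
  moreover have "app (yb_diff n) x = (- 1) ^ n * (\<Sum>s\<in>index_set n. app (gword s) x) +
      (\<Sum>s\<in>index_set n. app (hword s) x)" if "x \<in> tpower n" for x
    using k_linear_yb_diff k_linear_fun_add[OF G H] yb_diff_e that by (rule k_linear_eqI)
  ultimately show ?thesis by simp
qed

end
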